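(* Let $(\mathscr{C},\mathbb{E},\mathfrak{s})$ be a pre-extriangulated category. Then the conditions (ET4-1), (ET4-2) and (ET4-5) spelled out in the context are equivalent and self-dual. That is: $\mathscr{C}$ satisfies (ET4-1) if and only if it satisfies (ET4-2), if and only if it satisfies (ET4-5); and for each $X\in\{\text{(ET4-1)},\text{(ET4-2)},\text{(ET4-5)}\}$, $\mathscr{C}$ satisfies $X$ if and only if $\mathscr{C}$ satisfies the dual condition $X^{\mathrm{op}}$.
   Context: **Extensions.** Let $\mathscr{C}$ be an additive category and $\mathbb{E}:\mathscr{C}^{\mathrm{op}}\times\mathscr{C}\to\mathrm{Ab}$ a biadditive functor. An element $\delta\in\mathbb{E}(C,A)$ is an $\mathbb{E}$-extension. For $a:A\to A'$ put $a_*\delta=\mathbb{E}(C,a)(\delta)\in\mathbb{E}(C,A')$; for $c:C'\to C$ put $c^*\delta=\mathbb{E}(c,A)(\delta)\in\mathbb{E}(C',A)$. For $\delta\in\mathbb{E}(C,A)$, $\delta'\in\mathbb{E}(C',A')$, a morphism of $\mathbb{E}$-extensions $(a,c):\delta\to\delta'$ is a pair $a:A\to A'$, $c:C\to C'$ with $a_*\delta=c^*\delta'$. $\delta\oplus\delta'\in\mathbb{E}(C\oplus C',A\oplus A')$ is the element corresponding to $(\delta,0,0,\delta')$ under $\mathbb{E}(C\oplus C',A\oplus A')\cong\mathbb{E}(C,A)\oplus\mathbb{E}(C,A')\oplus\mathbb{E}(C',A)\oplus\mathbb{E}(C',A')$. **Realizations.** Sequences $A\xrightarrow{x}B\xrightarrow{y}C$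 and $A\xrightarrow{x'}B'\xrightarrow{y'}C$ are equivalent if there is an isomorphism $b:B\to B'$ with $bx=x'$, $y'b=y$; $[A\xrightarrow{x}B\xrightarrow{y}C]$ is the equivalence class. A realization $\mathfrak{s}$ of $\mathbb{E}$ assigns to each $\delta\in\mathbb{E}(C,A)$ an equivalence class $\mathfrak{s}(\delta)=[A\xrightarrow{x}B\xrightarrow{y}C]$ such that for every morphism of $\mathbb{E}$-extensions $(a,c):\delta\to\delta'$ with $\mathfrak{s}(\delta)=[A\xrightarrow{x}B\xrightarrow{y}C]$ and $\mathfrak{s}(\delta')=[A'\xrightarrow{x'}B'\xrightarrow{y'}C']$ there is $b:B\to B'$ with $bx=x'a$ and $y'b=cy$. It is additive if $\mathfrak{s}(0)=[A\xrightarrow{\binom{1}{0}}A\oplus C\xrightarrow{(0,1)}C]$ for $0\in\mathbb{E}(C,A)$, and $\mathfrak{s}(\delta\oplus\delta')=\mathfrak{s}(\delta)\oplus\mathfrak{s}(\delta')$ (termwise direct sum) for all $\delta,\delta'$. If $\mathfrak{s}(\delta)=[A\xrightarrow{x}B\xrightarrow{y}C]$, then $A\xrightarrow{x}B\xrightarrow{y}C\overset{\delta}{\dashrightarrow}$ is called an $\mathbb{E}$-triangle (realizing $\delta$). A morphism of $\mathbb{E}$-triangles from $A\xrightarrow{x}B\xrightarrow{y}C\overset{\delta}{\dashrightarrow}$ to $A'\xrightarrow{x'}B'\xrightarrow{y'}C'\overset{\delta'}{\dashrightarrow}$ is a triple $(a,b,c)$ with $bx=x'a$, $y'b=cy$ and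 $a_*\delta=c^*\delta'$. **Pre-extriangulated category.** A triple $(\mathscr{C},\mathbb{E},\mathfrak{s})$ with $\mathscr{C}$ additive such that: (ET1) $\mathbb{E}:\mathscr{C}^{\mathrm{op}}\times\mathscr{C}\to\mathrm{Ab}$ is a biadditive functor; (ET2) $\mathfrak{s}$ is an additive realization of $\mathbb{E}$; (ET3) for any two $\mathbb{E}$-triangles $A\xrightarrow{x}B\xrightarrow{y}C\overset{\delta}{\dashrightarrow}$ and $A'\xrightarrow{x'}B'\xrightarrow{y'}C'\overset{\delta'}{\dashrightarrow}$ and any $a:A\to A'$, $b:B\to B'$ with $bx=x'a$, there is $c:C\to C'$ such that $(a,b,c)$ is a morphism of $\mathbb{E}$-triangles; (ET3)$^{\mathrm{op}}$ for any two $\mathbb{E}$-triangles $A\xrightarrow{x}B\xrightarrow{y}C\overset{\delta}{\dashrightarrow}$ and $A'\xrightarrow{x'}B'\xrightarrow{y'}C'\overset{\delta'}{\dashrightarrow}$ and any $b:B\to B'$, $c:C\to C'$ with $y'b=cy$, there is $a:A\to A'$ such that $(a,b,c)$ is a morphism of $\mathbb{E}$-triangles. **Homotopy cartesian squares.** A commutative square $gx=yf$ with $x:A\to B$, $f:A\to C$, $g:B\to D$, $y:C\to D$ is homotopy cartesian with differential $\partial\in\mathbb{E}(D,A)$ if $A\xrightarrow{\binom{-f}{x}}C\oplus B\xrightarrow{(y,\,g)}D\overset{\partial}{\dashrightarrow}$ is an $\mathbb{E}$-triangle. **Conditions.** (ET4-1) For any $\mathbb{E}$-triangles $A_1\xrightarrow{x_1}B_1\xrightarrow{y_1}C\overset{\delta_1}{\dashrightarrow}$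 and $A_2\xrightarrow{x_2}B_2\xrightarrow{y_2}C\overset{\delta_2}{\dashrightarrow}$ there are an object $M$ and $\mathbb{E}$-triangles $A_1\xrightarrow{m_1}M\xrightarrow{e_1}B_2\overset{y_2^*\delta_1}{\dashrightarrow}$ and $A_2\xrightarrow{m_2}M\xrightarrow{e_2}B_1\overset{y_1^*\delta_2}{\dashrightarrow}$ such that $e_2m_1=x_1$, $e_1m_2=x_2$, $y_2e_1=y_1e_2$ and $(m_1)_*\delta_1+(m_2)_*\delta_2=0$. (ET4-2) For any $\mathbb{E}$-triangle $A\xrightarrow{x}B\xrightarrow{y}C\overset{\delta}{\dashrightarrow}$, any morphism $f:A\to D$, and any $\mathbb{E}$-triangle $D\xrightarrow{d}E\xrightarrow{e}C\overset{f_*\delta}{\dashrightarrow}$ realizing $f_*\delta$, there is $g:B\to E$ such that $(f,g,\mathrm{id}_C)$ is a morphism of $\mathbb{E}$-triangles (so $gx=df$, $eg=y$) and the square $gx=df$ is homotopy cartesian with differential $e^*\delta$, i.e. $A\xrightarrow{\binom{-f}{x}}D\oplus B\xrightarrow{(d,\,g)}E\overset{e^*\delta}{\dashrightarrow}$ is an $\mathbb{E}$-triangle. (ET4-5) For any $\mathbb{E}$-triangles $A_1\xrightarrow{x_1}B_1\xrightarrow{y_1}C\overset{\delta}{\dashrightarrow}$ and $A_2\xrightarrow{x_2}B_2\xrightarrow{y_2}C\overset{\delta'}{\dashrightarrow}$ and any $g:B_1\to B_2$ with $y_2g=y_1$, there is $f:A_1\to A_2$ such that $(f,g,\mathrm{id}_C)$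 is a morphism of $\mathbb{E}$-triangles (so $x_2f=gx_1$, $f_*\delta=\delta'$) and the square $x_2f=gx_1$ is homotopy cartesian with differential $y_2^*\delta$, i.e. $A_1\xrightarrow{\binom{-f}{x_1}}A_2\oplus B_1\xrightarrow{(x_2,\,g)}B_2\overset{y_2^*\delta}{\dashrightarrow}$ is an $\mathbb{E}$-triangle. **Duals.** The opposite category $\mathscr{C}^{\mathrm{op}}$ is pre-extriangulated with $\mathbb{E}^{\mathrm{op}}(C,A)=\mathbb{E}(A,C)$ and with the realization obtained by reversing arrows: if $\mathfrak{s}(\delta)=[C\to B\to A]$ for $\delta\in\mathbb{E}(A,C)$, then $\mathfrak{s}^{\mathrm{op}}(\delta)=[A\to B\to C]$ in $\mathscr{C}^{\mathrm{op}}$. For a condition $X$, $\mathscr{C}$ satisfies $X^{\mathrm{op}}$ means that $(\mathscr{C}^{\mathrm{op}},\mathbb{E}^{\mathrm{op}},\mathfrak{s}^{\mathrm{op}})$ satisfies $X$. *)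

theory Defs
  imports "HOL-Algebra.Group"
begin

text \<open>
  Additive categories. \<open>Mor X A B\<close> is the abelian group of morphisms from \<open>A\<close> to \<open>B\<close>. Abelian
  groups are rendered by \<^const>\<open>comm_group\<close>, whose operation is written multiplicatively; the
  abbreviations below restore the additive reading. The direct sum \<open>A \<oplus> B\<close> with its injections
  and projections is a chosen biproduct, the choice being part of the structure.
\<close>

record ('o, 'm) addcat =
  Obj :: "'o set"
  Mor :: "'o \<Rightarrow> 'o \<Rightarrow> 'm monoid"
  Comp :: "'m \<Rightarrow> 'm \<Rightarrow> 'm"  (infixr \<open>\<cdot>\<index>\<close> 75)
  Ident :: "'o \<Rightarrow> 'm"
  DSum :: "'o \<Rightarrow> 'o \<Rightarrow> 'o"
  Inj1 :: "'o \<Rightarrow> 'o \<Rightarrow> 'm"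
  Inj2 :: "'o \<Rightarrow> 'o \<Rightarrow> 'm"
  Prj1 :: "'o \<Rightarrow> 'o \<Rightarrow> 'm"
  Prj2 :: "'o \<Rightarrow> 'o \<Rightarrow> 'm"

abbreviation Hom :: "('o, 'm, 'z) addcat_scheme \<Rightarrow> 'o \<Rightarrow> 'o \<Rightarrow> 'm set" where
  "Hom X A B \<equiv> carrier (Mor X A B)"

abbreviation mor_add :: "('o, 'm, 'z) addcat_scheme \<Rightarrow> 'o \<Rightarrow> 'o \<Rightarrow> 'm \<Rightarrow> 'm \<Rightarrow> 'm" where
  "mor_add X A B f g \<equiv> f \<otimes>\<^bsub>Mor X A B\<^esub> g"

abbreviation mor_zero :: "('o, 'm, 'z) addcat_scheme \<Rightarrow> 'o \<Rightarrow> 'o \<Rightarrow> 'm" where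
  "mor_zero X A B \<equiv> \<one>\<^bsub>Mor X A B\<^esub>"

abbreviation mor_neg :: "('o, 'm, 'z) addcat_scheme \<Rightarrow> 'o \<Rightarrow> 'o \<Rightarrow> 'm \<Rightarrow> 'm" where
  "mor_neg X A B f \<equiv> inv\<^bsub>Mor X A B\<^esub> f"

locale additive_category =
  fixes X :: "('o, 'm, 'z) addcat_scheme" (structure)
  assumes hom_disjoint:
      "\<lbrakk>A \<in> Obj X; B \<in> Obj X; A' \<in> Obj X; B' \<in> Obj X; f \<in> Hom X A B; f \<in> Hom X A' B'\<rbrakk>
        \<Longrightarrow> A = A' \<and> B = B'"
    and comp_closed:
      "\<lbrakk>A \<in> Obj X; B \<in> Obj X; C \<in> Obj X; f \<in> Hom X A B; g \<in> Hom X B C\<rbrakk> \<Longrightarrow> g \<cdot> f \<in> Hom X A C"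
    and comp_assoc:
      "\<lbrakk>A \<in> Obj X; B \<in> Obj X; C \<in> Obj X; D \<in> Obj X;
        f \<in> Hom X A B; g \<in> Hom X B C; h \<in> Hom X C D\<rbrakk> \<Longrightarrow> (h \<cdot> g) \<cdot> f = h \<cdot> (g \<cdot> f)"
    and ident_closed: "A \<in> Obj X \<Longrightarrow> Ident X A \<in> Hom X A A"
    and ident_left: "\<lbrakk>A \<in> Obj X; B \<in> Obj X; f \<in> Hom X A B\<rbrakk> \<Longrightarrow> Ident X B \<cdot> f = f"
    and ident_right: "\<lbrakk>A \<in> Obj X; B \<in> Obj X; f \<in> Hom X A B\<rbrakk> \<Longrightarrow> f \<cdot> Ident X A = f"
    and hom_group: "\<lbrakk>A \<in> Obj X; B \<in> Obj X\<rbrakk> \<Longrightarrow> comm_group (Mor X A B)"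
    and comp_add_right:
      "\<lbrakk>A \<in> Obj X; B \<in> Obj X; C \<in> Obj X; f \<in> Hom X A B; f' \<in> Hom X A B; g \<in> Hom X B C\<rbrakk>
        \<Longrightarrow> g \<cdot> mor_add X A B f f' = mor_add X A C (g \<cdot> f) (g \<cdot> f')"
    and comp_add_left:
      "\<lbrakk>A \<in> Obj X; B \<in> Obj X; C \<in> Obj X; f \<in> Hom X A B; g \<in> Hom X B C; g' \<in> Hom X B C\<rbrakk>
        \<Longrightarrow> mor_add X B C g g' \<cdot> f = mor_add X A C (g \<cdot> f) (g' \<cdot> f)"
    and zero_object:
      "\<exists>Z\<in>Obj X. \<forall>A\<in>Obj X. Hom X Z A = {mor_zero X Z A} \<and> Hom X A Z = {mor_zero X A Z}"
    and dsum_closed: "\<lbrakk>A \<in> Obj X; B \<in> Obj X\<rbrakk> \<Longrightarrow> DSum X A B \<in> Obj X"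
    and inj1_closed: "\<lbrakk>A \<in> Obj X; B \<in> Obj X\<rbrakk> \<Longrightarrow> Inj1 X A B \<in> Hom X A (DSum X A B)"
    and inj2_closed: "\<lbrakk>A \<in> Obj X; B \<in> Obj X\<rbrakk> \<Longrightarrow> Inj2 X A B \<in> Hom X B (DSum X A B)"
    and prj1_closed: "\<lbrakk>A \<in> Obj X; B \<in> Obj X\<rbrakk> \<Longrightarrow> Prj1 X A B \<in> Hom X (DSum X A B) A"
    and prj2_closed: "\<lbrakk>A \<in> Obj X; B \<in> Obj X\<rbrakk> \<Longrightarrow> Prj2 X A B \<in> Hom X (DSum X A B) B"
    and prj1_inj1: "\<lbrakk>A \<in> Obj X; B \<in> Obj X\<rbrakk> \<Longrightarrow> Prj1 X A B \<cdot> Inj1 X A B = Ident X A"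
    and prj2_inj2: "\<lbrakk>A \<in> Obj X; B \<in> Obj X\<rbrakk> \<Longrightarrow> Prj2 X A B \<cdot> Inj2 X A B = Ident X B"
    and prj2_inj1: "\<lbrakk>A \<in> Obj X; B \<in> Obj X\<rbrakk> \<Longrightarrow> Prj2 X A B \<cdot> Inj1 X A B = mor_zero X A B"
    and prj1_inj2: "\<lbrakk>A \<in> Obj X; B \<in> Obj X\<rbrakk> \<Longrightarrow> Prj1 X A B \<cdot> Inj2 X A B = mor_zero X B A"
    and biproduct:
      "\<lbrakk>A \<in> Obj X; B \<in> Obj X\<rbrakk> \<Longrightarrow>
        mor_add X (DSum X A B) (DSum X A B)
          (Inj1 X A B \<cdot> Prj1 X A B) (Inj2 X A B \<cdot> Prj2 X A B) = Ident X (DSum X A B)"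

text \<open>
  \<open>col X A B C f g\<close> is the column with entries \<open>f : A \<rightarrow> B\<close> and \<open>g : A \<rightarrow> C\<close>, a morphism
  \<open>A \<rightarrow> B \<oplus> C\<close>; \<open>row X A B C f g\<close> is the row with entries \<open>f : A \<rightarrow> C\<close> and \<open>g : B \<rightarrow> C\<close>, a morphism
  \<open>A \<oplus> B \<rightarrow> C\<close>.
\<close>

definition col :: "('o, 'm, 'z) addcat_scheme \<Rightarrow> 'o \<Rightarrow> 'o \<Rightarrow> 'o \<Rightarrow> 'm \<Rightarrow> 'm \<Rightarrow> 'm" where
  "col X A B C f g =
     mor_add X A (DSum X B C) (Inj1 X B C \<cdot>\<^bsub>X\<^esub> f) (Inj2 X B C \<cdot>\<^bsub>X\<^esub> g)"

definition row :: "('o, 'm, 'z) addcat_scheme \<Rightarrow> 'o \<Rightarrow> 'o \<Rightarrow> 'o \<Rightarrow> 'm \<Rightarrow> 'm \<Rightarrow> 'm" where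
  "row X A B C f g =
     mor_add X (DSum X A B) C (f \<cdot>\<^bsub>X\<^esub> Prj1 X A B) (g \<cdot>\<^bsub>X\<^esub> Prj2 X A B)"

text \<open>\<open>f \<oplus> f' : A \<oplus> A' \<rightarrow> B \<oplus> B'\<close> for \<open>f : A \<rightarrow> B\<close> and \<open>f' : A' \<rightarrow> B'\<close>.\<close>

definition mor_dsum ::
    "('o, 'm, 'z) addcat_scheme \<Rightarrow> 'o \<Rightarrow> 'o \<Rightarrow> 'o \<Rightarrow> 'o \<Rightarrow> 'm \<Rightarrow> 'm \<Rightarrow> 'm" where
  "mor_dsum X A A' B B' f f' =
     mor_add X (DSum X A A') (DSum X B B')
       (Inj1 X B B' \<cdot>\<^bsub>X\<^esub> f \<cdot>\<^bsub>X\<^esub> Prj1 X A A') (Inj2 X B B' \<cdot>\<^bsub>X\<^esub> f' \<cdot>\<^bsub>X\<^esub> Prj2 X A A')"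

definition iso_mor :: "('o, 'm, 'z) addcat_scheme \<Rightarrow> 'o \<Rightarrow> 'o \<Rightarrow> 'm \<Rightarrow> bool" where
  "iso_mor X A B f \<longleftrightarrow> f \<in> Hom X A B \<and>
     (\<exists>g\<in>Hom X B A. g \<cdot>\<^bsub>X\<^esub> f = Ident X A \<and> f \<cdot>\<^bsub>X\<^esub> g = Ident X B)"

text \<open>
  A sequence \<open>A \<rightarrow> B \<rightarrow> C\<close> is the pair \<open>(x, y)\<close> of its morphisms; \<open>B\<close> is determined by \<open>x\<close>, as
  morphism sets are disjoint.
\<close>

definition sequences :: "('o, 'm, 'z) addcat_scheme \<Rightarrow> 'o \<Rightarrow> 'o \<Rightarrow> ('m \<times> 'm) set" where
  "sequences X A C = {(x, y). \<exists>B\<in>Obj X. x \<in> Hom X A B \<and> y \<in> Hom X B C}"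

definition seq_equiv ::
    "('o, 'm, 'z) addcat_scheme \<Rightarrow> 'o \<Rightarrow> 'o \<Rightarrow> (('m \<times> 'm) \<times> ('m \<times> 'm)) set" where
  "seq_equiv X A C = {((x, y), (x', y')).
     \<exists>B\<in>Obj X. \<exists>B'\<in>Obj X. \<exists>b.
       x \<in> Hom X A B \<and> y \<in> Hom X B C \<and> x' \<in> Hom X A B' \<and> y' \<in> Hom X B' C \<and>
       iso_mor X B B' b \<and> b \<cdot>\<^bsub>X\<^esub> x = x' \<and> y' \<cdot>\<^bsub>X\<^esub> b = y}"

definition seq_class ::
    "('o, 'm, 'z) addcat_scheme \<Rightarrow> 'o \<Rightarrow> 'o \<Rightarrow> 'm \<Rightarrow> 'm \<Rightarrow> ('m \<times> 'm) set" where
  "seq_class X A C x y = seq_equiv X A C `` {(x, y)}"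

text \<open>
  The data of a triple consisting of a category, a bifunctor and a realization: \<open>Ext X C A\<close> is the
  group of extensions of \<open>C\<close> by \<open>A\<close>; for \<open>c : C' \<rightarrow> C\<close> and \<open>a : A \<rightarrow> A'\<close>, \<open>Emap X c a\<close> is the induced
  map from \<open>Ext X C A\<close> to \<open>Ext X C' A'\<close>; \<open>Real X C A \<delta>\<close> is the equivalence class of sequences
  \<open>A \<rightarrow> B \<rightarrow> C\<close> assigned to \<open>\<delta>\<close>.
\<close>

record ('o, 'm, 'e) extcat = "('o, 'm) addcat" +
  Ext :: "'o \<Rightarrow> 'o \<Rightarrow> 'e monoid"
  Emap :: "'m \<Rightarrow> 'm \<Rightarrow> 'e \<Rightarrow> 'e"
  Real :: "'o \<Rightarrow> 'o \<Rightarrow> 'e \<Rightarrow> ('m \<times> 'm) set"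

abbreviation ext_add ::
    "('o, 'm, 'e, 'z) extcat_scheme \<Rightarrow> 'o \<Rightarrow> 'o \<Rightarrow> 'e \<Rightarrow> 'e \<Rightarrow> 'e" where
  "ext_add X C A \<delta> \<epsilon> \<equiv> \<delta> \<otimes>\<^bsub>Ext X C A\<^esub> \<epsilon>"

abbreviation ext_zero :: "('o, 'm, 'e, 'z) extcat_scheme \<Rightarrow> 'o \<Rightarrow> 'o \<Rightarrow> 'e" where
  "ext_zero X C A \<equiv> \<one>\<^bsub>Ext X C A\<^esub>"

definition push :: "('o, 'm, 'e, 'z) extcat_scheme \<Rightarrow> 'o \<Rightarrow> 'm \<Rightarrow> 'e \<Rightarrow> 'e" where
  "push X C a \<delta> = Emap X (Ident X C) a \<delta>"

definition pull :: "('o, 'm, 'e, 'z) extcat_scheme \<Rightarrow> 'o \<Rightarrow> 'm \<Rightarrow> 'e \<Rightarrow> 'e" where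
  "pull X A c \<delta> = Emap X c (Ident X A) \<delta>"

locale biadditive_ext = additive_category X
  for X :: "('o, 'm, 'e, 'z) extcat_scheme" (structure) +
  assumes ext_group: "\<lbrakk>C \<in> Obj X; A \<in> Obj X\<rbrakk> \<Longrightarrow> comm_group (Ext X C A)"
    and emap_hom:
      "\<lbrakk>C \<in> Obj X; C' \<in> Obj X; A \<in> Obj X; A' \<in> Obj X; c \<in> Hom X C' C; a \<in> Hom X A A'\<rbrakk>
        \<Longrightarrow> Emap X c a \<in> hom (Ext X C A) (Ext X C' A')"
    and emap_ident:
      "\<lbrakk>C \<in> Obj X; A \<in> Obj X; \<delta> \<in> carrier (Ext X C A)\<rbrakk>
        \<Longrightarrow> Emap X (Ident X C) (Ident X A) \<delta> = \<delta>"
    and emap_comp: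
      "\<lbrakk>C \<in> Obj X; C' \<in> Obj X; C'' \<in> Obj X; A \<in> Obj X; A' \<in> Obj X; A'' \<in> Obj X;
        c \<in> Hom X C' C; c' \<in> Hom X C'' C'; a \<in> Hom X A A'; a' \<in> Hom X A' A'';
        \<delta> \<in> carrier (Ext X C A)\<rbrakk>
        \<Longrightarrow> Emap X (c \<cdot> c') (a' \<cdot> a) \<delta> = Emap X c' a' (Emap X c a \<delta>)"
    and push_add:
      "\<lbrakk>C \<in> Obj X; A \<in> Obj X; A' \<in> Obj X; a \<in> Hom X A A'; a' \<in> Hom X A A';
        \<delta> \<in> carrier (Ext X C A)\<rbrakk>
        \<Longrightarrow> push X C (mor_add X A A' a a') \<delta> = ext_add X C A' (push X C a \<delta>) (push X C a' \<delta>)"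
    and pull_add:
      "\<lbrakk>C \<in> Obj X; C' \<in> Obj X; A \<in> Obj X; c \<in> Hom X C' C; c' \<in> Hom X C' C;
        \<delta> \<in> carrier (Ext X C A)\<rbrakk>
        \<Longrightarrow> pull X A (mor_add X C' C c c') \<delta> = ext_add X C' A (pull X A c \<delta>) (pull X A c' \<delta>)"

text \<open>
  The element \<open>\<delta> \<oplus> \<delta>'\<close>: the four components of an element of \<open>Ext X (C \<oplus> C') (A \<oplus> A')\<close> are
  obtained by pulling back along an injection and pushing forward along a projection.
\<close>

definition ext_dsum ::
    "('o, 'm, 'e, 'z) extcat_scheme \<Rightarrow> 'o \<Rightarrow> 'o \<Rightarrow> 'o \<Rightarrow> 'o \<Rightarrow> 'e \<Rightarrow> 'e \<Rightarrow> 'e" where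
  "ext_dsum X C A C' A' \<delta> \<delta>' =
     (THE \<rho>. \<rho> \<in> carrier (Ext X (DSum X C C') (DSum X A A')) \<and>
        Emap X (Inj1 X C C') (Prj1 X A A') \<rho> = \<delta> \<and>
        Emap X (Inj1 X C C') (Prj2 X A A') \<rho> = ext_zero X C A' \<and>
        Emap X (Inj2 X C C') (Prj1 X A A') \<rho> = ext_zero X C' A \<and>
        Emap X (Inj2 X C C') (Prj2 X A A') \<rho> = \<delta>')"

definition ext_mor ::
    "('o, 'm, 'e, 'z) extcat_scheme \<Rightarrow> 'o \<Rightarrow> 'o \<Rightarrow> 'o \<Rightarrow> 'o \<Rightarrow> 'e \<Rightarrow> 'e \<Rightarrow> 'm \<Rightarrow> 'm \<Rightarrow> bool" where
  "ext_mor X C A C' A' \<delta> \<delta>' a c \<longleftrightarrow>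
     a \<in> Hom X A A' \<and> c \<in> Hom X C C' \<and> push X C a \<delta> = pull X A' c \<delta>'"

text \<open>\<open>etriangle X (A, x, B, y, C, \<delta>)\<close>: \<open>A \<rightarrow> B \<rightarrow> C\<close>, with morphisms \<open>x\<close>, \<open>y\<close>, realizes \<open>\<delta>\<close>.\<close>

fun etriangle ::
    "('o, 'm, 'e, 'z) extcat_scheme \<Rightarrow> 'o \<times> 'm \<times> 'o \<times> 'm \<times> 'o \<times> 'e \<Rightarrow> bool" where
  "etriangle X (A, x, B, y, C, \<delta>) \<longleftrightarrow>
     A \<in> Obj X \<and> B \<in> Obj X \<and> C \<in> Obj X \<and> x \<in> Hom X A B \<and> y \<in> Hom X B C \<and>
     \<delta> \<in> carrier (Ext X C A) \<and> Real X C A \<delta> = seq_class X A C x y"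

fun etriangle_mor ::
    "('o, 'm, 'e, 'z) extcat_scheme \<Rightarrow> 'o \<times> 'm \<times> 'o \<times> 'm \<times> 'o \<times> 'e
      \<Rightarrow> 'o \<times> 'm \<times> 'o \<times> 'm \<times> 'o \<times> 'e \<Rightarrow> 'm \<times> 'm \<times> 'm \<Rightarrow> bool" where
  "etriangle_mor X (A, x, B, y, C, \<delta>) (A', x', B', y', C', \<delta>') (a, b, c) \<longleftrightarrow>
     a \<in> Hom X A A' \<and> b \<in> Hom X B B' \<and> c \<in> Hom X C C' \<and>
     b \<cdot>\<^bsub>X\<^esub> x = x' \<cdot>\<^bsub>X\<^esub> a \<and> y' \<cdot>\<^bsub>X\<^esub> b = c \<cdot>\<^bsub>X\<^esub> y \<and> push X C a \<delta> = pull X A' c \<delta>'"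

locale additive_realization = biadditive_ext +
  assumes real_class:
      "\<lbrakk>C \<in> Obj X; A \<in> Obj X; \<delta> \<in> carrier (Ext X C A)\<rbrakk>
        \<Longrightarrow> Real X C A \<delta> \<in> sequences X A C // seq_equiv X A C"
    and real_mor:
      "\<lbrakk>etriangle X (A, x, B, y, C, \<delta>); etriangle X (A', x', B', y', C', \<delta>');
        ext_mor X C A C' A' \<delta> \<delta>' a c\<rbrakk>
        \<Longrightarrow> \<exists>b\<in>Hom X B B'. b \<cdot> x = x' \<cdot> a \<and> y' \<cdot> b = c \<cdot> y"
    and real_zero:
      "\<lbrakk>C \<in> Obj X; A \<in> Obj X\<rbrakk> \<Longrightarrow>
        Real X C A (ext_zero X C A) =
          seq_class X A C (col X A A C (Ident X A) (mor_zero X A C))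
            (row X A C C (mor_zero X A C) (Ident X C))"
    and real_dsum:
      "\<lbrakk>etriangle X (A, x, B, y, C, \<delta>); etriangle X (A', x', B', y', C', \<delta>')\<rbrakk> \<Longrightarrow>
        Real X (DSum X C C') (DSum X A A') (ext_dsum X C A C' A' \<delta> \<delta>') =
          seq_class X (DSum X A A') (DSum X C C')
            (mor_dsum X A A' B B' x x') (mor_dsum X B B' C C' y y')"

locale pre_extriangulated = additive_realization +
  assumes ET3:
      "\<lbrakk>etriangle X (A, x, B, y, C, \<delta>); etriangle X (A', x', B', y', C', \<delta>');
        a \<in> Hom X A A'; b \<in> Hom X B B'; b \<cdot> x = x' \<cdot> a\<rbrakk>
        \<Longrightarrow> \<exists>c\<in>Hom X C C'.
              etriangle_mor X (A, x, B, y, C, \<delta>) (A', x', B', y', C', \<delta>') (a, b, c)"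
    and ET3_op:
      "\<lbrakk>etriangle X (A, x, B, y, C, \<delta>); etriangle X (A', x', B', y', C', \<delta>');
        b \<in> Hom X B B'; c \<in> Hom X C C'; y' \<cdot> b = c \<cdot> y\<rbrakk>
        \<Longrightarrow> \<exists>a\<in>Hom X A A'.
              etriangle_mor X (A, x, B, y, C, \<delta>) (A', x', B', y', C', \<delta>') (a, b, c)"

text \<open>The square \<open>g x = y f\<close> with \<open>x : A \<rightarrow> B\<close>, \<open>f : A \<rightarrow> C\<close>, \<open>g : B \<rightarrow> D\<close>, \<open>y : C \<rightarrow> D\<close>.\<close>

definition homotopy_cartesian ::
    "('o, 'm, 'e, 'z) extcat_scheme \<Rightarrow> 'o \<Rightarrow> 'o \<Rightarrow> 'o \<Rightarrow> 'o
      \<Rightarrow> 'm \<Rightarrow> 'm \<Rightarrow> 'm \<Rightarrow> 'm \<Rightarrow> 'e \<Rightarrow> bool" where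
  "homotopy_cartesian X A B C D x f g y \<theta> \<longleftrightarrow>
     x \<in> Hom X A B \<and> f \<in> Hom X A C \<and> g \<in> Hom X B D \<and> y \<in> Hom X C D \<and>
     g \<cdot>\<^bsub>X\<^esub> x = y \<cdot>\<^bsub>X\<^esub> f \<and>
     etriangle X (A, col X A C B (mor_neg X A C f) x, DSum X C B, row X C B D y g, D, \<theta>)"

definition ET4_1 :: "('o, 'm, 'e, 'z) extcat_scheme \<Rightarrow> bool" where
  "ET4_1 X \<longleftrightarrow>
    (\<forall>A1 x1 B1 y1 A2 x2 B2 y2 C \<delta>1 \<delta>2.
       etriangle X (A1, x1, B1, y1, C, \<delta>1) \<and> etriangle X (A2, x2, B2, y2, C, \<delta>2) \<longrightarrow>
       (\<exists>M m1 e1 m2 e2.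
          etriangle X (A1, m1, M, e1, B2, pull X A1 y2 \<delta>1) \<and>
          etriangle X (A2, m2, M, e2, B1, pull X A2 y1 \<delta>2) \<and>
          e2 \<cdot>\<^bsub>X\<^esub> m1 = x1 \<and> e1 \<cdot>\<^bsub>X\<^esub> m2 = x2 \<and> y2 \<cdot>\<^bsub>X\<^esub> e1 = y1 \<cdot>\<^bsub>X\<^esub> e2 \<and>
          ext_add X C M (push X C m1 \<delta>1) (push X C m2 \<delta>2) = ext_zero X C M))"

definition ET4_2 :: "('o, 'm, 'e, 'z) extcat_scheme \<Rightarrow> bool" where
  "ET4_2 X \<longleftrightarrow>
    (\<forall>A x B y C \<delta> D f d E e.
       etriangle X (A, x, B, y, C, \<delta>) \<and> D \<in> Obj X \<and> f \<in> Hom X A D \<and>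
       etriangle X (D, d, E, e, C, push X C f \<delta>) \<longrightarrow>
       (\<exists>g\<in>Hom X B E.
          etriangle_mor X (A, x, B, y, C, \<delta>) (D, d, E, e, C, push X C f \<delta>) (f, g, Ident X C) \<and>
          homotopy_cartesian X A B D E x f g d (pull X A e \<delta>)))"

definition ET4_5 :: "('o, 'm, 'e, 'z) extcat_scheme \<Rightarrow> bool" where
  "ET4_5 X \<longleftrightarrow>
    (\<forall>A1 x1 B1 y1 A2 x2 B2 y2 C \<delta> \<delta>' g.
       etriangle X (A1, x1, B1, y1, C, \<delta>) \<and> etriangle X (A2, x2, B2, y2, C, \<delta>') \<and>
       g \<in> Hom X B1 B2 \<and> y2 \<cdot>\<^bsub>X\<^esub> g = y1 \<longrightarrow>
       (\<exists>f\<in>Hom X A1 A2.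
          etriangle_mor X (A1, x1, B1, y1, C, \<delta>) (A2, x2, B2, y2, C, \<delta>') (f, g, Ident X C) \<and>
          homotopy_cartesian X A1 B1 A2 B2 x1 f g x2 (pull X A1 y2 \<delta>)))"

definition opposite :: "('o, 'm, 'e) extcat \<Rightarrow> ('o, 'm, 'e) extcat" where
  "opposite X =
    \<lparr>Obj = Obj X,
     Mor = (\<lambda>A B. Mor X B A),
     Comp = (\<lambda>g f. f \<cdot>\<^bsub>X\<^esub> g),
     Ident = Ident X,
     DSum = DSum X,
     Inj1 = Prj1 X,
     Inj2 = Prj2 X,
     Prj1 = Inj1 X,
     Prj2 = Inj2 X,
     Ext = (\<lambda>C A. Ext X A C),
     Emap = (\<lambda>c a. Emap X a c),
     Real = (\<lambda>C A \<delta>. prod.swap ` Real X A C \<delta>)\<rparr>"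

end

theory Submission
  imports Defs
begin

text \<open>
  The three conditions prescribe the same kind of square and differ in which morphisms are given.
  Two tools make the difference disappear. First, an extension triangle induces exact sequences:
  a morphism from \<open>A\<close> that kills \<open>\<delta>\<close> under pushforward factors through \<open>x\<close>, a morphism to \<open>C\<close> that kills \<open>\<delta>\<close>
  under pullback factors through \<open>y\<close>, and \<open>x\<close> is a weak kernel of \<open>y\<close>. So any two candidates for
  the missing morphism differ by a term \<open>h x\<close>, \<open>y h\<close> or \<open>x h\<close>. Secondly, such a term can be moved
  around: the automorphism of \<open>D \<oplus> B\<close> with entries \<open>1, -h, 0, 1\<close> turns the homotopy cartesian
  square of \<open>(f, g)\<close> into that of \<open>(f + h x, g + d h)\<close> (lemma \<open>shear\<close>). This settles the equivalence
  of (ET4-2) and (ET4-5). For (ET4-1) implies (ET4-2), apply (ET4-1) to \<open>\<delta>\<close> and \<open>f\<^sub>*\<delta>\<close>: as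
  \<open>y\<^sup>*f\<^sub>*\<delta> = f\<^sub>*y\<^sup>*\<delta> = 0\<close>, the object \<open>M\<close> is \<open>D \<oplus> B\<close>, and the relation between the two
  pushforwards says that the entry \<open>A \<rightarrow> D\<close> is \<open>-f\<close> up to a shear.

  The core is that (ET4-2) implies its dual. Let \<open>A \<rightarrow> B \<rightarrow> C\<close> realize \<open>\<delta>\<close>, let \<open>f : D \<rightarrow> C\<close>, and let
  \<open>A \<rightarrow> E \<rightarrow> D\<close> realize \<open>f\<^sup>*\<delta>\<close>, with inflation \<open>e\<close>. Push \<open>\<delta>\<close> out along \<open>e\<close>, with middle term \<open>G\<close>,
  and \<open>f\<^sup>*\<delta>\<close> out along \<open>-x\<close>; the second pushout is split, with middle term \<open>B \<oplus> D\<close>. By (ET4-2) both \<open>G\<close>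
  and \<open>B \<oplus> D\<close> are cones of one and the same morphism from \<open>A\<close> to \<open>E \<oplus> B\<close>, up to an isomorphism of the
  latter. So they are isomorphic, and the extension triangle \<open>E \<rightarrow> G \<rightarrow> C\<close> of the first pushout becomes the
  required extension triangle \<open>E \<rightarrow> D \<oplus> B \<rightarrow> C\<close> after a shear.

  The dual of (ET4-2) in turn implies (ET4-1). The two pullbacks, of \<open>y\<^sub>1\<close> along \<open>y\<^sub>2\<close> and of \<open>y\<^sub>2\<close>
  along \<open>y\<^sub>1\<close>, are both cocones of a morphism \<open>B\<^sub>1 \<oplus> B\<^sub>2 \<rightarrow> C\<close>; the two morphisms agree up to the sign
  \<open>-1\<close> on \<open>C\<close>. So the pullbacks are isomorphic, and the sign becomes the relation
  \<open>(m\<^sub>1)\<^sub>*\<delta>\<^sub>1 + (m\<^sub>2)\<^sub>*\<delta>\<^sub>2 = 0\<close>.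

  Hence (ET4-1), (ET4-2) and the dual of (ET4-2) are equivalent. Self-duality of the other conditions
  follows by using the equivalences in the opposite category as well, which is again
  pre-extriangulated.
\<close>

section \<open>Arithmetic in an additive category\<close>

context additive_category
begin

text \<open>
  Morphism sets are disjoint, so a morphism determines its source and target. Side conditions
  stated in terms of \<open>src\<close> and \<open>tgt\<close>, and sums that read off their hom group from the summands,
  turn the laws of an additive category into rewrite rules without undetermined objects.
\<close>

definition arr :: "'m \<Rightarrow> bool" where
  "arr f \<longleftrightarrow> (\<exists>A\<in>Obj X. \<exists>B\<in>Obj X. f \<in> Hom X A B)"

definition src :: "'m \<Rightarrow> 'o" where
  "src f = (THE A. A \<in> Obj X \<and> (\<exists>B\<in>Obj X. f \<in> Hom X A B))"

definition tgt :: "'m \<Rightarrow> 'o" where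
  "tgt f = (THE B. B \<in> Obj X \<and> (\<exists>A\<in>Obj X. f \<in> Hom X A B))"

definition plus :: "'m \<Rightarrow> 'm \<Rightarrow> 'm"  (infixl \<open>\<^bold>+\<close> 65) where
  "f \<^bold>+ g = mor_add X (src f) (tgt f) f g"

definition neg :: "'m \<Rightarrow> 'm"  (\<open>\<^bold>- _\<close> [80] 80) where
  "\<^bold>- f = mor_neg X (src f) (tgt f) f"

lemma src_tgt_eq:
  assumes "A \<in> Obj X" "B \<in> Obj X" "f \<in> Hom X A B"
  shows "src f = A" "tgt f = B"
proof -
  have unique: "A' = A \<and> B' = B" if "A' \<in> Obj X" "B' \<in> Obj X" "f \<in> Hom X A' B'" for A' B'
    using hom_disjoint[OF that(1,2) assms(1,2) that(3) assms(3)] .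
  show "src f = A"
    unfolding src_def
  proof (rule the_equality)
    show "A \<in> Obj X \<and> (\<exists>B\<in>Obj X. f \<in> Hom X A B)" using assms by blast
    show "A' = A" if "A' \<in> Obj X \<and> (\<exists>B\<in>Obj X. f \<in> Hom X A' B)" for A'
      using that unique by blast
  qed
  show "tgt f = B"
    unfolding tgt_def
  proof (rule the_equality)
    show "B \<in> Obj X \<and> (\<exists>A\<in>Obj X. f \<in> Hom X A B)" using assms by blast
    show "B' = B" if "B' \<in> Obj X \<and> (\<exists>A\<in>Obj X. f \<in> Hom X A B')" for B'
      using that unique by blast
  qed
qed

lemma arrE:
  assumes "arr f"
  obtains "src f \<in> Obj X" "tgt f \<in> Obj X" "f \<in> Hom X (src f) (tgt f)"
proof -
  obtain A B where h: "A \<in> Obj X" "B \<in> Obj X" "f \<in> Hom X A B"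
    using assms unfolding arr_def by blast
  show thesis by (rule that) (use h src_tgt_eq[OF h] in simp_all)
qed

lemma arr_obj [simp]: "arr f \<Longrightarrow> src f \<in> Obj X" "arr f \<Longrightarrow> tgt f \<in> Obj X"
  by (erule arrE, assumption)+

lemma Hom_iff [simp]:
  assumes "A \<in> Obj X" "B \<in> Obj X"
  shows "f \<in> Hom X A B \<longleftrightarrow> arr f \<and> src f = A \<and> tgt f = B"
proof
  assume f: "f \<in> Hom X A B"
  then have "arr f" unfolding arr_def using assms by blast
  then show "arr f \<and> src f = A \<and> tgt f = B" using src_tgt_eq[OF assms f] by simp
next
  assume "arr f \<and> src f = A \<and> tgt f = B"
  then show "f \<in> Hom X A B" by (auto elim: arrE)
qed

lemma arr_Hom: "arr f \<Longrightarrow> f \<in> Hom X (src f) (tgt f)"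
  by simp

lemma mor_add_plus [simp]:
  "\<lbrakk>arr f; src f = A; tgt f = B\<rbrakk> \<Longrightarrow> mor_add X A B f g = f \<^bold>+ g"
  by (simp add: plus_def)

lemma mor_neg_neg [simp]:
  "\<lbrakk>arr f; src f = A; tgt f = B\<rbrakk> \<Longrightarrow> mor_neg X A B f = \<^bold>- f"
  by (simp add: neg_def)

lemma comp_simps [simp]:
  assumes "arr f" "arr g" "src g = tgt f"
  shows "arr (g \<cdot> f)" "src (g \<cdot> f) = src f" "tgt (g \<cdot> f) = tgt g"
  using comp_closed[of "src f" "tgt f" "tgt g" f g] assms by auto

lemma comp_assoc' [simp]:
  "\<lbrakk>arr f; arr g; arr h; src g = tgt f; src h = tgt g\<rbrakk> \<Longrightarrow> (h \<cdot> g) \<cdot> f = h \<cdot> (g \<cdot> f)"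
  using comp_assoc[of "src f" "tgt f" "tgt g" "tgt h" f g h] by auto

lemma Ident_simps [simp]:
  assumes "A \<in> Obj X"
  shows "arr (Ident X A)" "src (Ident X A) = A" "tgt (Ident X A) = A"
  using ident_closed[OF assms] assms by auto

lemma Ident_comp [simp]: "\<lbrakk>arr f; tgt f = A\<rbrakk> \<Longrightarrow> Ident X A \<cdot> f = f"
  using ident_left[of "src f" "tgt f" f] by auto

lemma comp_Ident [simp]: "\<lbrakk>arr f; src f = A\<rbrakk> \<Longrightarrow> f \<cdot> Ident X A = f"
  using ident_right[of "src f" "tgt f" f] by auto

lemma zero_simps [simp]:
  assumes "A \<in> Obj X" "B \<in> Obj X"
  shows "arr (mor_zero X A B)" "src (mor_zero X A B) = A" "tgt (mor_zero X A B) = B"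
proof -
  interpret comm_group "Mor X A B" using hom_group assms by blast
  have "mor_zero X A B \<in> Hom X A B" by (rule one_closed)
  then show "arr (mor_zero X A B)" "src (mor_zero X A B) = A" "tgt (mor_zero X A B) = B"
    unfolding Hom_iff[OF assms] by auto
qed

lemma hom_group_of_arr:
  assumes "arr f"
  shows "comm_group (Mor X (src f) (tgt f))"
  using hom_group assms by simp

lemma plus_simps [simp]:
  assumes "arr f" "arr g" "src g = src f" "tgt g = tgt f"
  shows "arr (f \<^bold>+ g)" "src (f \<^bold>+ g) = src f" "tgt (f \<^bold>+ g) = tgt f"
proof -
  interpret comm_group "Mor X (src f) (tgt f)" using hom_group_of_arr assms by blast
  have "f \<^bold>+ g \<in> Hom X (src f) (tgt f)"
    unfolding plus_def using assms by (intro m_closed) simp_all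
  then show "arr (f \<^bold>+ g)" "src (f \<^bold>+ g) = src f" "tgt (f \<^bold>+ g) = tgt f"
    using assms by auto
qed

lemma neg_simps [simp]:
  assumes "arr f"
  shows "arr (\<^bold>- f)" "src (\<^bold>- f) = src f" "tgt (\<^bold>- f) = tgt f"
proof -
  interpret comm_group "Mor X (src f) (tgt f)" using hom_group_of_arr assms by blast
  have "\<^bold>- f \<in> Hom X (src f) (tgt f)"
    unfolding neg_def using assms by (intro inv_closed) simp_all
  then show "arr (\<^bold>- f)" "src (\<^bold>- f) = src f" "tgt (\<^bold>- f) = tgt f"
    using assms by auto
qed

lemma plus_assoc:
  assumes "arr f" "arr g" "arr h" "src g = src f" "tgt g = tgt f" "src h = src f" "tgt h = tgt f"
  shows "f \<^bold>+ g \<^bold>+ h = f \<^bold>+ (g \<^bold>+ h)"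
proof -
  interpret comm_group "Mor X (src f) (tgt f)" using hom_group_of_arr assms by blast
  show ?thesis using m_assoc[of f g h] assms by simp
qed

lemma plus_commute:
  assumes "arr f" "arr g" "src g = src f" "tgt g = tgt f"
  shows "f \<^bold>+ g = g \<^bold>+ f"
proof -
  interpret comm_group "Mor X (src f) (tgt f)" using hom_group_of_arr assms by blast
  show ?thesis using m_comm[of f g] assms by simp
qed

lemma plus_left_commute:
  assumes "arr f" "arr g" "arr h" "src g = src f" "tgt g = tgt f" "src h = src f" "tgt h = tgt f"
  shows "f \<^bold>+ (g \<^bold>+ h) = g \<^bold>+ (f \<^bold>+ h)"
  using assms plus_assoc plus_commute by metis

lemmas plus_ac = plus_assoc plus_commute plus_left_commute

lemma plus_zero [simp]:
  assumes "arr f" "src f = A" "tgt f = B"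
  shows "f \<^bold>+ mor_zero X A B = f" "mor_zero X A B \<^bold>+ f = f"
proof -
  interpret comm_group "Mor X A B" using hom_group_of_arr assms by blast
  have o: "A \<in> Obj X" "B \<in> Obj X" using assms by auto
  then have f: "f \<in> Hom X A B" using assms by simp
  show "f \<^bold>+ mor_zero X A B = f" "mor_zero X A B \<^bold>+ f = f"
    unfolding plus_def zero_simps[OF o] assms(2,3) by (rule r_one[OF f], rule l_one[OF f])
qed

lemma plus_neg [simp]:
  assumes "arr f"
  shows "f \<^bold>+ \<^bold>- f = mor_zero X (src f) (tgt f)" "\<^bold>- f \<^bold>+ f = mor_zero X (src f) (tgt f)"
proof -
  interpret comm_group "Mor X (src f) (tgt f)" using hom_group_of_arr assms by blast
  show "f \<^bold>+ \<^bold>- f = mor_zero X (src f) (tgt f)" "\<^bold>- f \<^bold>+ f = mor_zero X (src f) (tgt f)"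
    unfolding plus_def neg_def neg_simps[OF assms, unfolded neg_def]
    by (rule r_inv[OF arr_Hom[OF assms]], rule l_inv[OF arr_Hom[OF assms]])
qed

lemma plus_neg_cancel [simp]:
  assumes "arr f" "arr g" "src g = src f" "tgt g = tgt f"
  shows "f \<^bold>+ (\<^bold>- f \<^bold>+ g) = g" "\<^bold>- f \<^bold>+ (f \<^bold>+ g) = g"
  using plus_assoc[of f "\<^bold>- f" g] plus_assoc[of "\<^bold>- f" f g] assms by simp_all

lemma neg_unique:
  assumes "arr f" "arr g" "src g = src f" "tgt g = tgt f" "f \<^bold>+ g = mor_zero X (src f) (tgt f)"
  shows "g = \<^bold>- f"
  using plus_neg_cancel(2)[of f g] assms by simp

lemma neg_neg [simp]: "arr f \<Longrightarrow> \<^bold>- \<^bold>- f = f"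
  using neg_unique[of "\<^bold>- f" f] by simp

lemma neg_zero [simp]:
  "\<lbrakk>A \<in> Obj X; B \<in> Obj X\<rbrakk> \<Longrightarrow> \<^bold>- mor_zero X A B = mor_zero X A B"
  using neg_unique[of "mor_zero X A B" "mor_zero X A B"] by simp

lemma neg_plus [simp]:
  assumes "arr f" "arr g" "src g = src f" "tgt g = tgt f"
  shows "\<^bold>- (f \<^bold>+ g) = \<^bold>- f \<^bold>+ \<^bold>- g"
  by (rule neg_unique[symmetric]) (simp_all add: assms plus_ac)

lemma comp_plus [simp]:
  "\<lbrakk>arr f; arr f'; arr g; src f' = src f; tgt f' = tgt f; src g = tgt f\<rbrakk>
    \<Longrightarrow> g \<cdot> (f \<^bold>+ f') = g \<cdot> f \<^bold>+ g \<cdot> f'"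
  using comp_add_right[of "src f" "tgt f" "tgt g" f f' g] by simp

lemma plus_comp [simp]:
  "\<lbrakk>arr f; arr g; arr g'; src g' = src g; tgt g' = tgt g; src g = tgt f\<rbrakk>
    \<Longrightarrow> (g \<^bold>+ g') \<cdot> f = g \<cdot> f \<^bold>+ g' \<cdot> f"
  using comp_add_left[of "src f" "tgt f" "tgt g" f g g'] by simp

lemma idem_zero:
  assumes "arr f" "f \<^bold>+ f = f"
  shows "f = mor_zero X (src f) (tgt f)"
  using plus_neg_cancel(2)[of f f] assms by simp

lemma comp_zero [simp]:
  assumes "arr g" "A \<in> Obj X" "src g = B"
  shows "g \<cdot> mor_zero X A B = mor_zero X A (tgt g)"
proof -
  have "B \<in> Obj X" using assms by auto
  then show ?thesis
    using idem_zero[of "g \<cdot> mor_zero X A B"] comp_plus[of "mor_zero X A B" "mor_zero X A B" g] assms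
    by simp
qed

lemma zero_comp [simp]:
  assumes "arr f" "C \<in> Obj X" "tgt f = B"
  shows "mor_zero X B C \<cdot> f = mor_zero X (src f) C"
proof -
  have "B \<in> Obj X" using assms by auto
  then show ?thesis
    using idem_zero[of "mor_zero X B C \<cdot> f"] plus_comp[of f "mor_zero X B C" "mor_zero X B C"] assms
    by simp
qed

lemma comp_neg [simp]:
  assumes "arr f" "arr g" "src g = tgt f"
  shows "g \<cdot> \<^bold>- f = \<^bold>- (g \<cdot> f)" "\<^bold>- g \<cdot> f = \<^bold>- (g \<cdot> f)"
  using neg_unique[of "g \<cdot> f" "g \<cdot> \<^bold>- f"] neg_unique[of "g \<cdot> f" "\<^bold>- g \<cdot> f"]
    comp_plus[of f "\<^bold>- f" g] plus_comp[of f g "\<^bold>- g"] assms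
  by simp_all

lemma dsum_simps [simp]:
  assumes "A \<in> Obj X" "B \<in> Obj X"
  shows "DSum X A B \<in> Obj X"
    "arr (Inj1 X A B)" "src (Inj1 X A B) = A" "tgt (Inj1 X A B) = DSum X A B"
    "arr (Inj2 X A B)" "src (Inj2 X A B) = B" "tgt (Inj2 X A B) = DSum X A B"
    "arr (Prj1 X A B)" "src (Prj1 X A B) = DSum X A B" "tgt (Prj1 X A B) = A"
    "arr (Prj2 X A B)" "src (Prj2 X A B) = DSum X A B" "tgt (Prj2 X A B) = B"
  using inj1_closed[OF assms] inj2_closed[OF assms] prj1_closed[OF assms] prj2_closed[OF assms]
    dsum_closed[OF assms] assms
  by simp_all

lemma prj_inj [simp]:
  assumes "A \<in> Obj X" "B \<in> Obj X"
  shows "Prj1 X A B \<cdot> Inj1 X A B = Ident X A" "Prj2 X A B \<cdot> Inj2 X A B = Ident X B"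
    "Prj2 X A B \<cdot> Inj1 X A B = mor_zero X A B" "Prj1 X A B \<cdot> Inj2 X A B = mor_zero X B A"
  using assms prj1_inj1 prj2_inj2 prj2_inj1 prj1_inj2 by auto

lemma prj_inj_comp [simp]:
  assumes "A \<in> Obj X" "B \<in> Obj X" "arr f"
  shows "tgt f = A \<Longrightarrow> Prj1 X A B \<cdot> (Inj1 X A B \<cdot> f) = f"
    "tgt f = B \<Longrightarrow> Prj2 X A B \<cdot> (Inj2 X A B \<cdot> f) = f"
    "tgt f = A \<Longrightarrow> Prj2 X A B \<cdot> (Inj1 X A B \<cdot> f) = mor_zero X (src f) B"
    "tgt f = B \<Longrightarrow> Prj1 X A B \<cdot> (Inj2 X A B \<cdot> f) = mor_zero X (src f) A"
  using assms by (simp_all flip: comp_assoc')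

lemma dsum_ident:
  assumes "A \<in> Obj X" "B \<in> Obj X"
  shows "Inj1 X A B \<cdot> Prj1 X A B \<^bold>+ Inj2 X A B \<cdot> Prj2 X A B = Ident X (DSum X A B)"
  using biproduct[OF assms] assms by simp

text \<open>Together with its mirror image below, this replaces matrix calculus by a check of entries.\<close>

lemma into_dsum_eqI:
  assumes "arr u" "arr v" "src u = src v" "tgt u = DSum X A B" "tgt v = DSum X A B"
    "A \<in> Obj X" "B \<in> Obj X"
    "Prj1 X A B \<cdot> u = Prj1 X A B \<cdot> v" "Prj2 X A B \<cdot> u = Prj2 X A B \<cdot> v"
  shows "u = v"
proof -
  have "u = (Inj1 X A B \<cdot> Prj1 X A B \<^bold>+ Inj2 X A B \<cdot> Prj2 X A B) \<cdot> u"
    using assms(1-7) dsum_ident[of A B] by simp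
  also have "\<dots> = (Inj1 X A B \<cdot> Prj1 X A B \<^bold>+ Inj2 X A B \<cdot> Prj2 X A B) \<cdot> v"
    using assms by simp
  also have "\<dots> = v" using assms(1-7) dsum_ident[of A B] by simp
  finally show ?thesis .
qed

lemma from_dsum_eqI:
  assumes "arr u" "arr v" "tgt u = tgt v" "src u = DSum X A B" "src v = DSum X A B"
    "A \<in> Obj X" "B \<in> Obj X"
    "u \<cdot> Inj1 X A B = v \<cdot> Inj1 X A B" "u \<cdot> Inj2 X A B = v \<cdot> Inj2 X A B"
  shows "u = v"
proof -
  have "u = u \<cdot> (Inj1 X A B \<cdot> Prj1 X A B \<^bold>+ Inj2 X A B \<cdot> Prj2 X A B)"
    using assms(1-7) dsum_ident[of A B] by simp
  also have "\<dots> = v \<cdot> (Inj1 X A B \<cdot> Prj1 X A B \<^bold>+ Inj2 X A B \<cdot> Prj2 X A B)"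
    using assms by (simp flip: comp_assoc')
  also have "\<dots> = v" using assms(1-7) dsum_ident[of A B] by simp
  finally show ?thesis .
qed

lemma col_simps [simp]:
  assumes "arr f" "arr g" "src f = A" "src g = A" "tgt f = B" "tgt g = C"
  shows "arr (col X A B C f g)" "src (col X A B C f g) = A" "tgt (col X A B C f g) = DSum X B C"
    "Prj1 X B C \<cdot> col X A B C f g = f" "Prj2 X B C \<cdot> col X A B C f g = g"
  using assms by (auto simp: col_def)

lemma row_simps [simp]:
  assumes "arr f" "arr g" "src f = A" "src g = B" "tgt f = C" "tgt g = C"
  shows "arr (row X A B C f g)" "src (row X A B C f g) = DSum X A B" "tgt (row X A B C f g) = C"
    "row X A B C f g \<cdot> Inj1 X A B = f" "row X A B C f g \<cdot> Inj2 X A B = g"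
  using assms by (auto simp: row_def)

lemma row_col [simp]:
  assumes "arr f" "arr g" "src f = A" "src g = A" "tgt f = B" "tgt g = C"
    "arr u" "arr v" "src u = B" "src v = C" "tgt u = D" "tgt v = D"
  shows "row X B C D u v \<cdot> col X A B C f g = u \<cdot> f \<^bold>+ v \<cdot> g"
  using assms by (auto simp: row_def)

lemma col_comp [simp]:
  assumes "arr f" "arr g" "src f = A" "src g = A" "tgt f = B" "tgt g = C" "arr h" "tgt h = A"
  shows "col X A B C f g \<cdot> h = col X (src h) B C (f \<cdot> h) (g \<cdot> h)"
  using assms by (auto simp: col_def)

lemma col_eta:
  assumes "arr u" "tgt u = DSum X B C" "B \<in> Obj X" "C \<in> Obj X" "src u = A"
  shows "u = col X A B C (Prj1 X B C \<cdot> u) (Prj2 X B C \<cdot> u)"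
  by (rule into_dsum_eqI[of _ _ B C]) (use assms in auto)

lemma row_eta:
  assumes "arr u" "src u = DSum X A B" "A \<in> Obj X" "B \<in> Obj X" "tgt u = C"
  shows "u = row X A B C (u \<cdot> Inj1 X A B) (u \<cdot> Inj2 X A B)"
  by (rule from_dsum_eqI[of _ _ A B]) (use assms in auto)

definition inverses :: "'m \<Rightarrow> 'm \<Rightarrow> bool" where
  "inverses f g \<longleftrightarrow> arr f \<and> arr g \<and> src g = tgt f \<and> tgt g = src f \<and>
     g \<cdot> f = Ident X (src f) \<and> f \<cdot> g = Ident X (tgt f)"

lemma inversesD:
  assumes "inverses f g"
  shows "arr f" "arr g" "src g = tgt f" "tgt g = src f"
    "g \<cdot> f = Ident X (src f)" "f \<cdot> g = Ident X (tgt f)"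
  using assms by (auto simp: inverses_def)

lemma inverses_cancel:
  assumes "inverses f g" "arr h"
  shows "tgt h = src f \<Longrightarrow> g \<cdot> (f \<cdot> h) = h" "tgt h = tgt f \<Longrightarrow> f \<cdot> (g \<cdot> h) = h"
  using inversesD[OF assms(1)] assms(2) by (simp_all flip: comp_assoc')

lemma inverses_sym: "inverses f g \<Longrightarrow> inverses g f"
  by (auto simp: inverses_def)

lemma iso_mor_iff:
  assumes "A \<in> Obj X" "B \<in> Obj X"
  shows "iso_mor X A B f \<longleftrightarrow> (\<exists>g. inverses f g \<and> src f = A \<and> tgt f = B)"
  using assms by (auto simp: iso_mor_def inverses_def)

text \<open>With \<open>n = t - 1\<close> of square zero, \<open>1 - n\<close> inverts \<open>t = 1 + n\<close>.\<close>

lemma square_zero_inverses: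
  assumes "arr t" "src t = A" "tgt t = A"
    and "(t \<^bold>+ \<^bold>- Ident X A) \<cdot> (t \<^bold>+ \<^bold>- Ident X A) = mor_zero X A A"
  shows "\<exists>s. inverses t s"
proof -
  have o: "A \<in> Obj X" using assms by auto
  define n where "n = t \<^bold>+ \<^bold>- Ident X A"
  have n: "arr n" "src n = A" "tgt n = A" "n \<cdot> n = mor_zero X A A"
    using assms o by (simp_all add: n_def)
  have t: "t = Ident X A \<^bold>+ n"
    using assms o unfolding n_def by (simp add: plus_left_commute[of "Ident X A" t])
  have "inverses t (Ident X A \<^bold>+ \<^bold>- n)"
    unfolding inverses_def t using n(1-3) o by (simp add: n(4) plus_assoc)
  then show ?thesis by blast
qed

text \<open>The composites provide a left inverse and a right inverse of \<open>f\<close>, which then coincide.\<close>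

lemma iso_if_both_composites_iso:
  assumes "arr f" "arr g" "src g = tgt f" "tgt g = src f"
    "inverses (g \<cdot> f) s" "inverses (f \<cdot> g) r"
  shows "\<exists>h. inverses f h"
proof -
  note S = inversesD[OF assms(5)] and R = inversesD[OF assms(6)]
  have l: "(s \<cdot> g) \<cdot> f = Ident X (src f)" using S assms(1-4) by simp
  have r: "f \<cdot> (g \<cdot> r) = Ident X (tgt f)" using R assms(1-4) by simp
  have "s \<cdot> g = (s \<cdot> g) \<cdot> (f \<cdot> (g \<cdot> r))" unfolding r using S assms(1-4) by simp
  also have "\<dots> = ((s \<cdot> g) \<cdot> f) \<cdot> (g \<cdot> r)"
    by (rule comp_assoc'[symmetric]) (use S R assms(1-4) in simp_all)
  also have "\<dots> = g \<cdot> r" unfolding l using R assms(1-4) by simp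
  finally have "inverses f (s \<cdot> g)"
    unfolding inverses_def using l r S R assms(1-4) by simp
  then show ?thesis by blast
qed

end

section \<open>Extensions and realizations\<close>

context biadditive_ext
begin

lemma emap_closed [simp]:
  assumes "\<delta> \<in> carrier (Ext X (tgt c) (src a))" "arr c" "arr a" "src c = C" "tgt a = A"
  shows "Emap X c a \<delta> \<in> carrier (Ext X C A)"
  using emap_hom[of "tgt c" "src c" "src a" "tgt a" c a] assms hom_in_carrier by fastforce

lemma emap_emap [simp]:
  assumes "\<delta> \<in> carrier (Ext X (tgt c) (src a))" "arr c" "arr c'" "arr a" "arr a'"
    "tgt c' = src c" "src a' = tgt a"
  shows "Emap X c' a' (Emap X c a \<delta>) = Emap X (c \<cdot> c') (a' \<cdot> a) \<delta>"
  using emap_comp[of "tgt c" "src c" "src c'" "src a" "tgt a" "tgt a'" c c' a a' \<delta>] assms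
  by simp

lemma emap_zero [simp]:
  assumes "arr c" "arr a" "tgt c = C" "src a = A"
  shows "Emap X c a (ext_zero X C A) = ext_zero X (src c) (tgt a)"
proof -
  have "C \<in> Obj X" "A \<in> Obj X" using assms by auto
  then show ?thesis
    using hom_one[OF emap_hom[of C "src c" A "tgt a" c a]] assms ext_group
    by (simp add: comm_group.axioms)
qed

lemma ext_zero_closed [simp]:
  assumes "C \<in> Obj X" "A \<in> Obj X"
  shows "ext_zero X C A \<in> carrier (Ext X C A)"
proof -
  interpret E: comm_group "Ext X C A" using ext_group assms .
  show ?thesis by simp
qed

lemma ext_add_zero [simp]:
  assumes "C \<in> Obj X" "A \<in> Obj X" "\<delta> \<in> carrier (Ext X C A)"
  shows "ext_add X C A \<delta> (ext_zero X C A) = \<delta>" "ext_add X C A (ext_zero X C A) \<delta> = \<delta>"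
proof -
  interpret E: comm_group "Ext X C A" using ext_group assms(1,2) .
  show "ext_add X C A \<delta> (ext_zero X C A) = \<delta>" "ext_add X C A (ext_zero X C A) \<delta> = \<delta>"
    using assms by simp_all
qed

lemma push_ext_add:
  assumes "\<delta> \<in> carrier (Ext X C A)" "\<epsilon> \<in> carrier (Ext X C A)" "C \<in> Obj X" "arr a" "src a = A"
  shows "push X C a (ext_add X C A \<delta> \<epsilon>) = ext_add X C (tgt a) (push X C a \<delta>) (push X C a \<epsilon>)"
proof -
  have "Emap X (Ident X C) a \<in> hom (Ext X C A) (Ext X C (tgt a))"
    using emap_hom[of C C A "tgt a" "Ident X C" a] arr_obj[of a] assms by simp
  then show ?thesis unfolding push_def by (rule hom_mult) (use assms in simp_all)
qed

lemma push_closed [simp]: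
  "\<lbrakk>\<delta> \<in> carrier (Ext X C (src a)); C \<in> Obj X; arr a; tgt a = A\<rbrakk>
    \<Longrightarrow> push X C a \<delta> \<in> carrier (Ext X C A)"
  by (simp add: push_def)

lemma pull_closed [simp]:
  "\<lbrakk>\<delta> \<in> carrier (Ext X (tgt c) A); A \<in> Obj X; arr c; src c = C\<rbrakk>
    \<Longrightarrow> pull X A c \<delta> \<in> carrier (Ext X C A)"
  by (simp add: pull_def)

lemma push_push:
  "\<lbrakk>\<delta> \<in> carrier (Ext X C (src a)); C \<in> Obj X; arr a; arr b; src b = tgt a\<rbrakk>
    \<Longrightarrow> push X C b (push X C a \<delta>) = push X C (b \<cdot> a) \<delta>"
  by (simp add: push_def)

lemma pull_pull:
  "\<lbrakk>\<delta> \<in> carrier (Ext X (tgt c) A); A \<in> Obj X; arr c; arr b; tgt b = src c\<rbrakk>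
    \<Longrightarrow> pull X A b (pull X A c \<delta>) = pull X A (c \<cdot> b) \<delta>"
  by (simp add: pull_def)

lemma push_pull:
  "\<lbrakk>\<delta> \<in> carrier (Ext X (tgt c) (src a)); arr a; arr c; src c = C; src a = A\<rbrakk>
    \<Longrightarrow> push X C a (pull X A c \<delta>) = pull X (tgt a) c (push X (tgt c) a \<delta>)"
  using arr_obj[of a] arr_obj[of c] by (simp add: push_def pull_def)

lemma push_Ident [simp]:
  "\<lbrakk>\<delta> \<in> carrier (Ext X C A); C \<in> Obj X; A \<in> Obj X\<rbrakk> \<Longrightarrow> push X C (Ident X A) \<delta> = \<delta>"
  by (simp add: push_def emap_ident)

lemma pull_Ident [simp]:
  "\<lbrakk>\<delta> \<in> carrier (Ext X C A); C \<in> Obj X; A \<in> Obj X\<rbrakk> \<Longrightarrow> pull X A (Ident X C) \<delta> = \<delta>"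
  by (simp add: pull_def emap_ident)

lemma push_ext_zero [simp]:
  "\<lbrakk>C \<in> Obj X; arr a; src a = A\<rbrakk> \<Longrightarrow> push X C a (ext_zero X C A) = ext_zero X C (tgt a)"
  by (simp add: push_def)

lemma pull_ext_zero [simp]:
  "\<lbrakk>A \<in> Obj X; arr c; tgt c = C\<rbrakk> \<Longrightarrow> pull X A c (ext_zero X C A) = ext_zero X (src c) A"
  by (simp add: pull_def)

lemma push_plus:
  "\<lbrakk>\<delta> \<in> carrier (Ext X C (src a)); C \<in> Obj X; arr a; arr a'; src a' = src a; tgt a' = tgt a\<rbrakk>
    \<Longrightarrow> push X C (a \<^bold>+ a') \<delta> = ext_add X C (tgt a) (push X C a \<delta>) (push X C a' \<delta>)"
  using push_add[of C "src a" "tgt a" a a' \<delta>] by simp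

lemma pull_plus:
  "\<lbrakk>\<delta> \<in> carrier (Ext X (tgt c) A); A \<in> Obj X; arr c; arr c'; src c' = src c; tgt c' = tgt c\<rbrakk>
    \<Longrightarrow> pull X A (c \<^bold>+ c') \<delta> = ext_add X (src c) A (pull X A c \<delta>) (pull X A c' \<delta>)"
  using pull_add[of "tgt c" "src c" A c c' \<delta>] by simp

lemma ext_idem_zero:
  assumes "C \<in> Obj X" "A \<in> Obj X" "\<delta> \<in> carrier (Ext X C A)" "ext_add X C A \<delta> \<delta> = \<delta>"
  shows "\<delta> = ext_zero X C A"
proof -
  interpret E: comm_group "Ext X C A" using ext_group assms(1,2) .
  show ?thesis using E.l_cancel_one[OF assms(3,3)] assms(4) by simp
qed

lemma push_zero [simp]:
  "\<lbrakk>\<delta> \<in> carrier (Ext X C A); C \<in> Obj X; A \<in> Obj X; A' \<in> Obj X\<rbrakk>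
    \<Longrightarrow> push X C (mor_zero X A A') \<delta> = ext_zero X C A'"
  using push_plus[of \<delta> C "mor_zero X A A'" "mor_zero X A A'"]
  by (intro ext_idem_zero) simp_all

lemma pull_zero [simp]:
  "\<lbrakk>\<delta> \<in> carrier (Ext X C A); C \<in> Obj X; A \<in> Obj X; C' \<in> Obj X\<rbrakk>
    \<Longrightarrow> pull X A (mor_zero X C' C) \<delta> = ext_zero X C' A"
  using pull_plus[of \<delta> "mor_zero X C' C" A "mor_zero X C' C"]
  by (intro ext_idem_zero) simp_all

lemma push_diff_zero:
  assumes "\<delta> \<in> carrier (Ext X C (src a))" "C \<in> Obj X" "arr a" "arr a'" "src a' = src a"
    "tgt a' = tgt a" "push X C a \<delta> = push X C a' \<delta>"
  shows "push X C (a \<^bold>+ \<^bold>- a') \<delta> = ext_zero X C (tgt a)"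
proof -
  have "push X C (a \<^bold>+ \<^bold>- a') \<delta> = push X C (a' \<^bold>+ \<^bold>- a') \<delta>"
    using assms push_plus[of \<delta> C a "\<^bold>- a'"] push_plus[of \<delta> C a' "\<^bold>- a'"] by simp
  then show ?thesis using assms by simp
qed

lemma pull_diff_zero:
  assumes "\<delta> \<in> carrier (Ext X (tgt c) A)" "A \<in> Obj X" "arr c" "arr c'" "src c' = src c"
    "tgt c' = tgt c" "pull X A c \<delta> = pull X A c' \<delta>"
  shows "pull X A (c \<^bold>+ \<^bold>- c') \<delta> = ext_zero X (src c) A"
proof -
  have "pull X A (c \<^bold>+ \<^bold>- c') \<delta> = pull X A (c' \<^bold>+ \<^bold>- c') \<delta>"
    using assms pull_plus[of \<delta> c A "\<^bold>- c'"] pull_plus[of \<delta> c' A "\<^bold>- c'"] by simp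
  then show ?thesis using assms by simp
qed

lemma seq_equivE:
  assumes "((x, y), (x', y')) \<in> seq_equiv X A C" "A \<in> Obj X" "C \<in> Obj X"
  obtains B B' b b' where "arr x" "src x = A" "tgt x = B" "arr y" "src y = B" "tgt y = C"
    "arr x'" "src x' = A" "tgt x' = B'" "arr y'" "src y' = B'" "tgt y' = C"
    "inverses b b'" "src b = B" "tgt b = B'" "b \<cdot> x = x'" "y' \<cdot> b = y"
  using assms by (auto simp: seq_equiv_def iso_mor_iff)

lemma seq_equivI:
  assumes "arr x" "src x = A" "tgt x = B" "arr y" "src y = B" "tgt y = C"
    and "arr x'" "src x' = A" "tgt x' = B'" "arr y'" "src y' = B'" "tgt y' = C"
    and "inverses b b'" "src b = B" "tgt b = B'" "b \<cdot> x = x'" "y' \<cdot> b = y"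
  shows "((x, y), (x', y')) \<in> seq_equiv X A C"
proof -
  have o: "A \<in> Obj X" "B \<in> Obj X" "B' \<in> Obj X" "C \<in> Obj X" using assms by auto
  have "iso_mor X B B' b" using assms o by (auto simp: iso_mor_iff)
  then have "B \<in> Obj X \<and> B' \<in> Obj X \<and> x \<in> Hom X A B \<and> y \<in> Hom X B C \<and> x' \<in> Hom X A B' \<and>
      y' \<in> Hom X B' C \<and> iso_mor X B B' b \<and> b \<cdot> x = x' \<and> y' \<cdot> b = y"
    using assms o by simp
  then show ?thesis unfolding seq_equiv_def by blast
qed

lemma equiv_seq_equiv:
  assumes o: "A \<in> Obj X" "C \<in> Obj X"
  shows "equiv (sequences X A C) (seq_equiv X A C)"
proof (rule equivI)
  show "seq_equiv X A C \<subseteq> sequences X A C \<times> sequences X A C"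
    unfolding seq_equiv_def sequences_def by auto
  show "refl_on (sequences X A C) (seq_equiv X A C)"
  proof (rule refl_onI)
    fix s assume "s \<in> sequences X A C"
    then obtain x B y where s: "s = (x, y)" "B \<in> Obj X" "arr x" "src x = A" "tgt x = B"
      "arr y" "src y = B" "tgt y = C"
      using assms by (auto simp: sequences_def)
    then have "inverses (Ident X B) (Ident X B)"
      by (simp add: inverses_def)
    then show "(s, s) \<in> seq_equiv X A C"
      unfolding s(1) by (rule seq_equivI[rotated 12]) (use s in simp_all)
  qed
  show "sym (seq_equiv X A C)"
  proof (rule symI)
    fix s t assume st: "(s, t) \<in> seq_equiv X A C"
    obtain x y x' y' where e: "s = (x, y)" "t = (x', y')" by fastforce
    from st[unfolded e] o show "(t, s) \<in> seq_equiv X A C"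
      unfolding e
    proof (rule seq_equivE)
      fix B B' b b'
      assume *: "arr x" "src x = A" "tgt x = B" "arr y" "src y = B" "tgt y = C"
        "arr x'" "src x' = A" "tgt x' = B'" "arr y'" "src y' = B'" "tgt y' = C"
        and b: "inverses b b'" "src b = B" "tgt b = B'" and eq: "b \<cdot> x = x'" "y' \<cdot> b = y"
      show "((x', y'), (x, y)) \<in> seq_equiv X A C"
      proof (rule seq_equivI)
        show "inverses b' b" using b(1) by (rule inverses_sym)
        show "b' \<cdot> x' = x" using * b inverses_cancel(1)[OF b(1), of x] by (simp flip: eq(1))
        show "y \<cdot> b' = y'"
          using * b inversesD[OF b(1)] comp_assoc'[of b' b y'] by (simp flip: eq(2))
      qed (use * b inversesD[OF b(1)] in simp_all)
    qed
  qed
  show "trans (seq_equiv X A C)"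
  proof (rule transI)
    fix r s t assume rs: "(r, s) \<in> seq_equiv X A C" "(s, t) \<in> seq_equiv X A C"
    obtain x y x' y' x'' y'' where e: "r = (x, y)" "s = (x', y')" "t = (x'', y'')" by (metis surj_pair)
    from rs(1)[unfolded e] o show "(r, t) \<in> seq_equiv X A C"
      unfolding e
    proof (rule seq_equivE)
      fix B B' b b'
      assume 1: "arr x" "src x = A" "tgt x = B" "arr y" "src y = B" "tgt y = C"
        "arr x'" "src x' = A" "tgt x' = B'" "arr y'" "src y' = B'" "tgt y' = C"
        and b: "inverses b b'" "src b = B" "tgt b = B'" and bx: "b \<cdot> x = x'" "y' \<cdot> b = y"
      from rs(2)[unfolded e] o show "((x, y), (x'', y'')) \<in> seq_equiv X A C"
      proof (rule seq_equivE)
        fix D B'' c c'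
        assume 2: "arr x'" "src x' = A" "tgt x' = D" "arr y'" "src y' = D" "tgt y' = C"
          "arr x''" "src x'' = A" "tgt x'' = B''" "arr y''" "src y'' = B''" "tgt y'' = C"
          and c: "inverses c c'" "src c = D" "tgt c = B''" and cx: "c \<cdot> x' = x''" "y'' \<cdot> c = y'"
        have D: "D = B'" using 1 2 by simp
        note bi = inversesD[OF b(1)] inverses_cancel[OF b(1)]
        note ci = inversesD[OF c(1)] inverses_cancel[OF c(1)]
        show "((x, y), (x'', y'')) \<in> seq_equiv X A C"
        proof (rule seq_equivI)
          show "inverses (c \<cdot> b) (b' \<cdot> c')"
            unfolding inverses_def using bi ci b(2,3) c(2,3) D by simp
          show "(c \<cdot> b) \<cdot> x = x''" using 1 b c D bi ci bx cx by simp
          show "y'' \<cdot> (c \<cdot> b) = y"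
            using 2 b c D bi ci comp_assoc'[of b c y''] by (simp add: bx cx)
        qed (use 1 2 b c D bi ci in simp_all)
      qed
    qed
  qed
qed

end

declare etriangle.simps [simp del] etriangle_mor.simps [simp del]

context additive_realization
begin

lemma etriangleD:
  assumes "etriangle X (A, x, B, y, C, \<delta>)"
  shows "A \<in> Obj X" "B \<in> Obj X" "C \<in> Obj X" "arr x" "src x = A" "tgt x = B"
    "arr y" "src y = B" "tgt y = C" "\<delta> \<in> carrier (Ext X C A)"
  using assms by (auto simp: etriangle.simps)

lemma etriangle_exists:
  assumes "C \<in> Obj X" "A \<in> Obj X" "\<delta> \<in> carrier (Ext X C A)"
  shows "\<exists>x B y. etriangle X (A, x, B, y, C, \<delta>)"
proof -
  obtain s where s: "s \<in> sequences X A C" "Real X C A \<delta> = seq_equiv X A C `` {s}"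
    using real_class[OF assms] by (rule quotientE)
  obtain x y B where "s = (x, y)" "B \<in> Obj X" "x \<in> Hom X A B" "y \<in> Hom X B C"
    using s(1) unfolding sequences_def by blast
  then have "etriangle X (A, x, B, y, C, \<delta>)"
    using s(2) assms by (simp add: etriangle.simps seq_class_def)
  then show ?thesis by blast
qed

text \<open>
  A realization is only an equivalence class of sequences, so the middle term may be replaced along
  any isomorphism. All changes of matrix entries below are instances of this.
\<close>

lemma etriangle_transport:
  assumes T: "etriangle X (A, x, B, y, C, \<delta>)" and b: "inverses b b'" "src b = B" "tgt b = B'"
  shows "etriangle X (A, b \<cdot> x, B', y \<cdot> b', C, \<delta>)"
proof -
  note t = etriangleD[OF T] and bb = inversesD[OF b(1)] inverses_cancel[OF b(1)]
  have "B' \<in> Obj X" using b bb by auto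
  moreover have "((x, y), (b \<cdot> x, y \<cdot> b')) \<in> seq_equiv X A C"
    by (rule seq_equivI[OF _ _ _ _ _ _ _ _ _ _ _ _ b]) (use t b bb in simp_all)
  then have "seq_class X A C x y = seq_class X A C (b \<cdot> x) (y \<cdot> b')"
    unfolding seq_class_def using equiv_class_eq[OF equiv_seq_equiv] t by blast
  ultimately show ?thesis using T t b bb by (auto simp: etriangle.simps)
qed

lemma etriangle_unique:
  assumes T: "etriangle X (A, x, B, y, C, \<delta>)" and T': "etriangle X (A, x', B', y', C, \<delta>)"
  obtains b b' where "inverses b b'" "src b = B" "tgt b = B'" "b \<cdot> x = x'" "y' \<cdot> b = y"
proof -
  note t = etriangleD[OF T] and t' = etriangleD[OF T']
  have "((x', y'), (x', y')) \<in> seq_equiv X A C"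
    using equiv_class_self[OF equiv_seq_equiv, of A C "(x', y')"] t t'
    by (auto simp: sequences_def)
  moreover have "seq_class X A C x y = seq_class X A C x' y'"
    using T T' by (simp add: etriangle.simps)
  ultimately have "((x, y), (x', y')) \<in> seq_equiv X A C"
    by (auto simp: seq_class_def)
  then show thesis using t(1,3)
  proof (rule seq_equivE)
    fix B0 B0' b b'
    assume "tgt x = B0" "tgt x' = B0'" "inverses b b'" "src b = B0" "tgt b = B0'" "b \<cdot> x = x'" "y' \<cdot> b = y"
    then show thesis using that t t' by simp
  qed
qed

text \<open>
  Every exactness statement below comes from comparing a given triangle with a split one,
  often with a zero object as one of its ends.
\<close>

lemma split_etriangle:
  assumes "A \<in> Obj X" "C \<in> Obj X"
  shows "etriangle X (A, Inj1 X A C, DSum X A C, Prj2 X A C, C, ext_zero X C A)"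
proof -
  have "col X A A C (Ident X A) (mor_zero X A C) = Inj1 X A C"
    "row X A C C (mor_zero X A C) (Ident X C) = Prj2 X A C"
    using assms by (simp_all add: col_def row_def)
  then show ?thesis using assms real_zero[of C A] by (simp add: etriangle.simps)
qed

text \<open>
  The automorphism \<open>1 - i\<^sub>1 h p\<^sub>2\<close> of \<open>D \<oplus> B\<close> subtracts \<open>h x\<close> from the first entry of the column,
  and its inverse \<open>1 + i\<^sub>1 h p\<^sub>2\<close> adds \<open>d h\<close> to the second entry of the row.
\<close>

lemma shear:
  assumes T: "etriangle X (A, col X A D B u x, DSum X D B, row X D B E d g, E, \<theta>)"
    and u: "arr u" "src u = A" "tgt u = D" and x: "arr x" "src x = A" "tgt x = B"
    and d: "arr d" "src d = D" "tgt d = E" and g: "arr g" "src g = B" "tgt g = E"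
    and h: "arr h" "src h = B" "tgt h = D"
  shows "etriangle X (A, col X A D B (u \<^bold>+ \<^bold>- (h \<cdot> x)) x, DSum X D B,
    row X D B E d (g \<^bold>+ d \<cdot> h), E, \<theta>)"
proof -
  define n where "n = Inj1 X D B \<cdot> (h \<cdot> Prj2 X D B)"
  have o: "A \<in> Obj X" "B \<in> Obj X" "D \<in> Obj X" "E \<in> Obj X" using x d by auto
  have n: "arr n" "src n = DSum X D B" "tgt n = DSum X D B" "n \<cdot> n = mor_zero X (DSum X D B) (DSum X D B)"
    using o h by (simp_all add: n_def)
  define t where "t = Ident X (DSum X D B) \<^bold>+ \<^bold>- n"
  define t' where "t' = Ident X (DSum X D B) \<^bold>+ n"
  have t: "inverses t t'" "src t = DSum X D B" "tgt t = DSum X D B"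
    unfolding inverses_def t_def t'_def using n(1-3) o by (simp_all add: n(4) plus_assoc)
  have "t \<cdot> col X A D B u x = col X A D B (u \<^bold>+ \<^bold>- (h \<cdot> x)) x"
    by (rule into_dsum_eqI[of _ _ D B]) (use o u x h in \<open>simp_all add: t_def n_def\<close>)
  moreover have "row X D B E d g \<cdot> t' = row X D B E d (g \<^bold>+ d \<cdot> h)"
    by (rule from_dsum_eqI[of _ _ D B]) (use o d g h in \<open>simp_all add: t'_def n_def row_def\<close>)
  ultimately show ?thesis using etriangle_transport[OF T t] by simp
qed

end

section \<open>Exactness of extension triangles\<close>

context pre_extriangulated
begin

lemma etriangle_morD:
  assumes "etriangle_mor X (A, x, B, y, C, \<delta>) (A', x', B', y', C', \<delta>') (a, b, c)"
    and "etriangle X (A, x, B, y, C, \<delta>)" "etriangle X (A', x', B', y', C', \<delta>')"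
  shows "arr a" "src a = A" "tgt a = A'" "arr b" "src b = B" "tgt b = B'"
    "arr c" "src c = C" "tgt c = C'" "b \<cdot> x = x' \<cdot> a" "y' \<cdot> b = c \<cdot> y"
    "push X C a \<delta> = pull X A' c \<delta>'"
  using assms etriangleD[OF assms(2)] etriangleD[OF assms(3)] by (auto simp: etriangle_mor.simps)

lemma ET3E:
  assumes T: "etriangle X (A, x, B, y, C, \<delta>)" and T': "etriangle X (A', x', B', y', C', \<delta>')"
    and "arr a" "src a = A" "tgt a = A'" "arr b" "src b = B" "tgt b = B'" "b \<cdot> x = x' \<cdot> a"
  obtains c where "etriangle_mor X (A, x, B, y, C, \<delta>) (A', x', B', y', C', \<delta>') (a, b, c)"
proof -
  have "\<exists>c\<in>Hom X C C'. etriangle_mor X (A, x, B, y, C, \<delta>) (A', x', B', y', C', \<delta>') (a, b, c)"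
    by (rule ET3[OF T T']) (use assms etriangleD[OF T] etriangleD[OF T'] in simp_all)
  then show thesis using that by blast
qed

lemma ET3_opE:
  assumes T: "etriangle X (A, x, B, y, C, \<delta>)" and T': "etriangle X (A', x', B', y', C', \<delta>')"
    and "arr b" "src b = B" "tgt b = B'" "arr c" "src c = C" "tgt c = C'" "y' \<cdot> b = c \<cdot> y"
  obtains a where "etriangle_mor X (A, x, B, y, C, \<delta>) (A', x', B', y', C', \<delta>') (a, b, c)"
proof -
  have "\<exists>a\<in>Hom X A A'. etriangle_mor X (A, x, B, y, C, \<delta>) (A', x', B', y', C', \<delta>') (a, b, c)"
    by (rule ET3_op[OF T T']) (use assms etriangleD[OF T] etriangleD[OF T'] in simp_all)
  then show thesis using that by blast
qed

text \<open>
  The morphism \<open>i\<^sub>2 y\<close> into the split triangle on a zero object \<open>Z\<close> and \<open>C\<close> lies over the identity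
  of \<open>C\<close>, so it restricts to some \<open>A \<rightarrow> Z\<close>; hence \<open>y x = p\<^sub>2 i\<^sub>2 y x\<close> factors through \<open>p\<^sub>2 i\<^sub>1 = 0\<close>.
\<close>

lemma etriangle_comp_zero:
  assumes T: "etriangle X (A, x, B, y, C, \<delta>)"
  shows "y \<cdot> x = mor_zero X A C"
proof -
  note t = etriangleD[OF T]
  obtain Z where Z: "Z \<in> Obj X" using zero_object by blast
  note S = split_etriangle[OF Z t(3)]
  obtain a where m: "etriangle_mor X (A, x, B, y, C, \<delta>)
      (Z, Inj1 X Z C, DSum X Z C, Prj2 X Z C, C, ext_zero X C Z) (a, Inj2 X Z C \<cdot> y, Ident X C)"
    by (rule ET3_opE[OF T S, of "Inj2 X Z C \<cdot> y" "Ident X C"]) (use t Z in simp_all)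
  note a = etriangle_morD[OF m T S]
  have "y \<cdot> x = Prj2 X Z C \<cdot> ((Inj2 X Z C \<cdot> y) \<cdot> x)" using t Z by simp
  also have "\<dots> = mor_zero X A C" unfolding a(10) using a(1-3) t Z by simp
  finally show ?thesis .
qed

text \<open>
  Compare with the split triangle on \<open>B\<close> and a zero object: \<open>x\<close> extends to a morphism of triangles,
  so \<open>x\<^sub>*\<delta>\<close> is a pullback of the zero extension. The next lemma is dual.
\<close>

lemma push_inflation:
  assumes T: "etriangle X (A, x, B, y, C, \<delta>)"
  shows "push X C x \<delta> = ext_zero X C B"
proof -
  note t = etriangleD[OF T]
  obtain Z where Z: "Z \<in> Obj X" using zero_object by blast
  note S = split_etriangle[OF t(2) Z]
  obtain c where m: "etriangle_mor X (A, x, B, y, C, \<delta>)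
      (B, Inj1 X B Z, DSum X B Z, Prj2 X B Z, Z, ext_zero X Z B) (x, Inj1 X B Z, c)"
    by (rule ET3E[OF T S, of x "Inj1 X B Z"]) (use t Z in simp_all)
  show ?thesis using etriangle_morD[OF m T S] t by simp
qed

lemma pull_deflation:
  assumes T: "etriangle X (A, x, B, y, C, \<delta>)"
  shows "pull X A y \<delta> = ext_zero X B A"
proof -
  note t = etriangleD[OF T]
  obtain Z where Z: "Z \<in> Obj X" using zero_object by blast
  note S = split_etriangle[OF Z t(2)]
  obtain a where m: "etriangle_mor X
      (Z, Inj1 X Z B, DSum X Z B, Prj2 X Z B, B, ext_zero X B Z) (A, x, B, y, C, \<delta>) (a, Prj2 X Z B, y)"
    by (rule ET3_opE[OF S T, of "Prj2 X Z B" y]) (use t Z in simp_all)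
  show ?thesis using etriangle_morD[OF m S T] t by simp
qed

text \<open>
  If \<open>a\<^sub>*\<delta> = 0\<close>, then \<open>a\<close> and the identity of \<open>C\<close> form a morphism from \<open>\<delta>\<close> to the zero extension.
  A realization of it, followed by the projection of the split middle term, extends \<open>a\<close> along \<open>x\<close>.
\<close>

lemma factors_through_inflation:
  assumes T: "etriangle X (A, x, B, y, C, \<delta>)" and a: "arr a" "src a = A" "tgt a = W"
    and 0: "push X C a \<delta> = ext_zero X C W"
  obtains h where "arr h" "src h = B" "tgt h = W" "a = h \<cdot> x"
proof -
  note t = etriangleD[OF T]
  have W: "W \<in> Obj X" using a by auto
  note S = split_etriangle[OF W t(3)]
  have "ext_mor X C A C W \<delta> (ext_zero X C W) a (Ident X C)"
    unfolding ext_mor_def using a 0 t W by simp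
  then obtain b where b: "b \<in> Hom X B (DSum X W C)" "b \<cdot> x = Inj1 X W C \<cdot> a"
    using real_mor[OF T S] by blast
  have b': "arr b" "src b = B" "tgt b = DSum X W C" using b(1) t W by simp_all
  have "a = Prj1 X W C \<cdot> (Inj1 X W C \<cdot> a)" using a t W by simp
  also have "\<dots> = (Prj1 X W C \<cdot> b) \<cdot> x" unfolding b(2)[symmetric] using b' t W by simp
  finally show thesis using that[of "Prj1 X W C \<cdot> b"] b' t W by simp
qed

lemma factors_through_deflation:
  assumes T: "etriangle X (A, x, B, y, C, \<delta>)" and c: "arr c" "src c = W" "tgt c = C"
    and 0: "pull X A c \<delta> = ext_zero X W A"
  obtains h where "arr h" "src h = W" "tgt h = B" "c = y \<cdot> h"
proof -
  note t = etriangleD[OF T]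
  have W: "W \<in> Obj X" using c by auto
  note S = split_etriangle[OF t(1) W]
  have "ext_mor X W A C A (ext_zero X W A) \<delta> (Ident X A) c"
    unfolding ext_mor_def using c 0 t W by simp
  then obtain b where b: "b \<in> Hom X (DSum X A W) B" "y \<cdot> b = c \<cdot> Prj2 X A W"
    using real_mor[OF S T] by blast
  have b': "arr b" "src b = DSum X A W" "tgt b = B" using b(1) t W by simp_all
  have "c = (c \<cdot> Prj2 X A W) \<cdot> Inj2 X A W" using c t W by simp
  also have "\<dots> = y \<cdot> (b \<cdot> Inj2 X A W)" unfolding b(2)[symmetric] using b' t W by simp
  finally show thesis using that[of "b \<cdot> Inj2 X A W"] b' t W by simp
qed

text \<open>
  With a zero object \<open>Z\<close>, the morphism \<open>g p\<^sub>1\<close> from \<open>W \<oplus> Z\<close> to \<open>B\<close> lies over \<open>0 : Z \<rightarrow> C\<close>, so it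
  restricts to some \<open>h : W \<rightarrow> A\<close>, and \<open>x h = g p\<^sub>1 i\<^sub>1 = g\<close>.
\<close>

lemma inflation_weak_kernel:
  assumes T: "etriangle X (A, x, B, y, C, \<delta>)" and g: "arr g" "src g = W" "tgt g = B"
    and 0: "y \<cdot> g = mor_zero X W C"
  obtains h where "arr h" "src h = W" "tgt h = A" "g = x \<cdot> h"
proof -
  note t = etriangleD[OF T]
  obtain Z where Z: "Z \<in> Obj X" using zero_object by blast
  have W: "W \<in> Obj X" using g by auto
  note S = split_etriangle[OF W Z]
  have "y \<cdot> (g \<cdot> Prj1 X W Z) = (y \<cdot> g) \<cdot> Prj1 X W Z" using g t W Z by simp
  also have "\<dots> = mor_zero X Z C \<cdot> Prj2 X W Z" unfolding 0 using g t W Z by simp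
  finally have sq: "y \<cdot> (g \<cdot> Prj1 X W Z) = mor_zero X Z C \<cdot> Prj2 X W Z" .
  obtain a where m: "etriangle_mor X
      (W, Inj1 X W Z, DSum X W Z, Prj2 X W Z, Z, ext_zero X Z W) (A, x, B, y, C, \<delta>)
      (a, g \<cdot> Prj1 X W Z, mor_zero X Z C)"
    by (rule ET3_opE[OF S T _ _ _ _ _ _ sq]) (use g t W Z in simp_all)
  show thesis using etriangle_morD[OF m S T] that[of a] g W Z by simp
qed

text \<open>
  The difference \<open>n = c - 1\<close> satisfies \<open>n y = 0\<close> and \<open>n\<^sup>*\<delta> = 0\<close>. By the latter it factors as
  \<open>n = y s\<close>, whence \<open>n n = n y s = 0\<close>.
\<close>

lemma etriangle_endo_iso:
  assumes T: "etriangle X (A, x, B, y, C, \<delta>)" and c: "arr c" "src c = C" "tgt c = C"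
    and cy: "c \<cdot> y = y" and pl: "pull X A c \<delta> = \<delta>"
  shows "\<exists>c'. inverses c c'"
proof -
  note t = etriangleD[OF T]
  define n where "n = c \<^bold>+ \<^bold>- Ident X C"
  have n: "arr n" "src n = C" "tgt n = C" using t c by (simp_all add: n_def)
  have ny: "n \<cdot> y = mor_zero X B C" using t c cy by (simp add: n_def)
  have "pull X A n \<delta> = ext_zero X C A"
    using pull_diff_zero[of \<delta> c A "Ident X C"] t c pl by (simp add: n_def)
  then obtain s where s: "arr s" "src s = C" "tgt s = B" "n = y \<cdot> s"
    using factors_through_deflation[OF T n] by blast
  have "n \<cdot> n = (n \<cdot> y) \<cdot> s" using n t s(1-3) by (subst (2) s(4)) simp
  also have "\<dots> = mor_zero X C C" unfolding ny using s t by simp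
  finally show ?thesis using square_zero_inverses[OF c] by (simp add: n_def)
qed

text \<open>
  Extending the inverses of \<open>a\<close> and \<open>b\<close> gives \<open>c'\<close> in the opposite direction. It need not invert \<open>c\<close>,
  but both composites of \<open>c\<close> and \<open>c'\<close> are endomorphisms as in the preceding lemma, hence invertible.
\<close>

lemma etriangle_mor_iso:
  assumes T: "etriangle X (A, x, B, y, C, \<delta>)" and T': "etriangle X (A', x', B', y', C', \<delta>')"
    and m: "etriangle_mor X (A, x, B, y, C, \<delta>) (A', x', B', y', C', \<delta>') (a, b, c)"
    and "iso_mor X A A' a" "iso_mor X B B' b"
  shows "iso_mor X C C' c"
proof -
  note t = etriangleD[OF T] and t' = etriangleD[OF T'] and f = etriangle_morD[OF m T T']
  obtain a' b' where a: "inverses a a'" and b: "inverses b b'"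
    using assms(4,5) t t' by (auto simp: iso_mor_iff)
  note ai = inversesD[OF a] inverses_cancel[OF a] and bi = inversesD[OF b] inverses_cancel[OF b]
  have "b' \<cdot> x' = b' \<cdot> ((x' \<cdot> a) \<cdot> a')" using t' f ai by simp
  also have "\<dots> = x \<cdot> a'" unfolding f(10)[symmetric] using t t' f(1-9) ai bi by simp
  finally have sq: "b' \<cdot> x' = x \<cdot> a'" .
  obtain c' where m': "etriangle_mor X (A', x', B', y', C', \<delta>') (A, x, B, y, C, \<delta>) (a', b', c')"
    by (rule ET3E[OF T' T _ _ _ _ _ _ sq]) (use f(1-9) ai bi in simp_all)
  note f' = etriangle_morD[OF m' T' T]
  have "(c' \<cdot> c) \<cdot> y = c' \<cdot> (y' \<cdot> b)" unfolding f(11) using t f(1-9) f'(1-9) by simp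
  also have "\<dots> = (y \<cdot> b') \<cdot> b" unfolding f'(11) using t t' f(1-9) f'(1-9) by simp
  also have "\<dots> = y" using t f(1-9) bi by simp
  finally have 1: "(c' \<cdot> c) \<cdot> y = y" .
  have "(c \<cdot> c') \<cdot> y' = c \<cdot> (y \<cdot> b')" unfolding f'(11) using t' f(1-9) f'(1-9) by simp
  also have "\<dots> = (y' \<cdot> b) \<cdot> b'" unfolding f(11) using t t' f(1-9) f'(1-9) by simp
  also have "\<dots> = y'" using t' f(1-9) bi by simp
  finally have 2: "(c \<cdot> c') \<cdot> y' = y'" .
  have "pull X A (c' \<cdot> c) \<delta> = pull X A c (push X C' a' \<delta>')"
    unfolding f'(12) using t f(1-9) f'(1-9) by (simp add: pull_pull)
  also have "\<dots> = push X C a' (push X C a \<delta>)"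
    unfolding f(12) using t t' f(1-9) f'(1-9) push_pull[of \<delta>' c a'] by simp
  also have "\<dots> = \<delta>" using t f(1-9) ai by (simp add: push_push)
  finally have 3: "pull X A (c' \<cdot> c) \<delta> = \<delta>" .
  have "pull X A' (c \<cdot> c') \<delta>' = pull X A' c' (push X C a \<delta>)"
    unfolding f(12) using t' f(1-9) f'(1-9) by (simp add: pull_pull)
  also have "\<dots> = push X C' a (push X C' a' \<delta>')"
    unfolding f'(12) using t t' f(1-9) f'(1-9) push_pull[of \<delta> c' a] by simp
  also have "\<dots> = \<delta>'" using t' f(1-9) ai by (simp add: push_push)
  finally have 4: "pull X A' (c \<cdot> c') \<delta>' = \<delta>'" .
  obtain s where s: "inverses (c' \<cdot> c) s"
    using etriangle_endo_iso[OF T _ _ _ 1 3] f(7-9) f'(7-9) by auto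
  obtain r where r: "inverses (c \<cdot> c') r"
    using etriangle_endo_iso[OF T' _ _ _ 2 4] f(7-9) f'(7-9) by auto
  show ?thesis
    using iso_if_both_composites_iso[OF f(7) f'(7) _ _ s r] f(7-9) f'(7-9) t t'
    by (simp add: iso_mor_iff)
qed

end

section \<open>Passing between the conditions\<close>

text \<open>
  (ET4-2) for the opposite category, written out in the category itself. The opposite of a column is a
  row, so here the sign of the homotopy cartesian square sits in the second morphism.
\<close>

definition ET4_2_dual :: "('o, 'm, 'e, 'z) extcat_scheme \<Rightarrow> bool" where
  "ET4_2_dual X \<longleftrightarrow>
    (\<forall>A x B y C \<delta> D f E e d.
       etriangle X (A, x, B, y, C, \<delta>) \<and> D \<in> Obj X \<and> f \<in> Hom X D C \<and>
       etriangle X (A, e, E, d, D, pull X A f \<delta>) \<longrightarrow>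
       (\<exists>g\<in>Hom X E B. g \<cdot>\<^bsub>X\<^esub> e = x \<and> y \<cdot>\<^bsub>X\<^esub> g = f \<cdot>\<^bsub>X\<^esub> d \<and>
          etriangle X (E, col X E D B d g, DSum X D B, row X D B C (mor_neg X D C f) y, C,
            push X C e \<delta>)))"

context pre_extriangulated
begin

text \<open>The square commutes because the two morphisms of an extension triangle compose to zero.\<close>

lemma homotopy_cartesianI:
  assumes T: "etriangle X (A, col X A D B (\<^bold>- f) x, DSum X D B, row X D B E d g, E, \<theta>)"
    and f: "arr f" "src f = A" "tgt f = D" and x: "arr x" "src x = A" "tgt x = B"
    and d: "arr d" "src d = D" "tgt d = E" and g: "arr g" "src g = B" "tgt g = E"
  shows "homotopy_cartesian X A B D E x f g d \<theta>" "g \<cdot> x = d \<cdot> f"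
proof -
  have o: "A \<in> Obj X" "B \<in> Obj X" "D \<in> Obj X" "E \<in> Obj X" using x d by auto
  have "\<^bold>- (d \<cdot> f) \<^bold>+ g \<cdot> x = mor_zero X A E"
    using etriangle_comp_zero[OF T] f x d g by simp
  then show eq: "g \<cdot> x = d \<cdot> f"
    using neg_unique[of "\<^bold>- (d \<cdot> f)" "g \<cdot> x"] f x d g by simp
  show "homotopy_cartesian X A B D E x f g d \<theta>"
    unfolding homotopy_cartesian_def using o f x d g eq T by simp
qed

lemma homotopy_cartesianD:
  assumes "homotopy_cartesian X A B D E x f g d \<theta>" "arr f" "src f = A" "tgt f = D"
  shows "etriangle X (A, col X A D B (\<^bold>- f) x, DSum X D B, row X D B E d g, E, \<theta>)"
  using assms by (simp add: homotopy_cartesian_def)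

text \<open>
  Apply the hypothesis to \<open>\<delta>\<close> and \<open>f\<^sub>*\<delta>\<close>. The extension of \<open>B\<close> by \<open>D\<close> with middle term \<open>M\<close> is
  \<open>y\<^sup>*f\<^sub>*\<delta> = 0\<close>, so \<open>M\<close> may be taken to be \<open>D \<oplus> B\<close>, and the other triangle becomes one from \<open>A\<close> to
  \<open>D \<oplus> B\<close> to \<open>E\<close>. Only its entry \<open>a : A \<rightarrow> D\<close> can differ from what is required, and this by a shear.
\<close>

lemma ET4_1_imp_ET4_2:
  assumes E1: "ET4_1 X"
  shows "ET4_2 X"
  unfolding ET4_2_def
proof (intro allI impI, elim conjE)
  fix A x B y C \<delta> D f d E e
  assume T: "etriangle X (A, x, B, y, C, \<delta>)" and D: "D \<in> Obj X" and fH: "f \<in> Hom X A D"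
    and T': "etriangle X (D, d, E, e, C, push X C f \<delta>)"
  note t = etriangleD[OF T] and t' = etriangleD[OF T']
  have f: "arr f" "src f = A" "tgt f = D" using fH t D by simp_all
  obtain M m1 e1 m2 e2 where M1: "etriangle X (A, m1, M, e1, E, pull X A e \<delta>)"
    and M2: "etriangle X (D, m2, M, e2, B, pull X D y (push X C f \<delta>))"
    and sq: "e2 \<cdot> m1 = x" "e1 \<cdot> m2 = d" "e \<cdot> e1 = y \<cdot> e2"
    and sum: "ext_add X C M (push X C m1 \<delta>) (push X C m2 (push X C f \<delta>)) = ext_zero X C M"
    using E1[unfolded ET4_1_def, rule_format, OF conjI[OF T T']] by blast
  note m1 = etriangleD[OF M1] and m2 = etriangleD[OF M2]
  have "pull X D y (push X C f \<delta>) = push X B f (pull X A y \<delta>)"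
    using t f push_pull[of \<delta> y f] by simp
  also have "\<dots> = ext_zero X B D" using pull_deflation[OF T] t f by simp
  finally have M2': "etriangle X (D, m2, M, e2, B, ext_zero X B D)" using M2 by simp
  obtain p q where pq: "inverses p q" "src p = M" "tgt p = DSum X D B"
    and p: "p \<cdot> m2 = Inj1 X D B" "Prj2 X D B \<cdot> p = e2"
    by (rule etriangle_unique[OF M2' split_etriangle[OF D t(2)]]) auto
  note pi = inversesD[OF pq(1)] inverses_cancel[OF pq(1)]
  have q: "q \<cdot> Inj1 X D B = m2"
    using pi pq(2,3) m2 by (simp flip: p(1))
  define a where "a = Prj1 X D B \<cdot> (p \<cdot> m1)"
  define k where "k = e1 \<cdot> (q \<cdot> Inj2 X D B)"
  have a: "arr a" "src a = A" "tgt a = D" and k: "arr k" "src k = B" "tgt k = E"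
    using pi pq(2,3) m1 m2 D t by (simp_all add: a_def k_def)
  have "Prj2 X D B \<cdot> (p \<cdot> m1) = x"
    using pi pq(2,3) m1 m2 D t comp_assoc'[of m1 p "Prj2 X D B"] by (simp add: p(2) sq(1))
  then have col: "p \<cdot> m1 = col X A D B a x"
    using col_eta[of "p \<cdot> m1" D B A] pi pq(2,3) m1 m2 D t by (simp add: a_def)
  have row: "e1 \<cdot> q = row X D B E d k"
    using row_eta[of "e1 \<cdot> q" D B E] pi pq(2,3) m1 m2 D t by (simp add: k_def q sq(2))
  have H: "etriangle X (A, col X A D B a x, DSum X D B, row X D B E d k, E, pull X A e \<delta>)"
    using etriangle_transport[OF M1 pq] unfolding col row .
  have "e \<cdot> k = (e \<cdot> e1) \<cdot> (q \<cdot> Inj2 X D B)"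
    using pi pq(2,3) m1 m2 D t t' by (simp add: k_def)
  also have "\<dots> = y \<cdot> ((Prj2 X D B \<cdot> p) \<cdot> (q \<cdot> Inj2 X D B))"
    unfolding sq(3) p(2) using pi pq(2,3) m1 m2 D t t' by simp
  also have "\<dots> = y" using pi pq(2,3) m1 m2 D t t' by simp
  finally have ek: "e \<cdot> k = y" .
  \<comment> \<open>Project the relation between the two pushforwards to the summand \<open>D\<close>.\<close>
  have "ext_zero X C D = push X C (Prj1 X D B \<cdot> p)
      (ext_add X C M (push X C m1 \<delta>) (push X C m2 (push X C f \<delta>)))"
    unfolding sum using pi pq(2,3) D t by simp
  also have "\<dots> = ext_add X C D (push X C (Prj1 X D B \<cdot> p) (push X C m1 \<delta>))
      (push X C (Prj1 X D B \<cdot> p) (push X C m2 (push X C f \<delta>)))"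
    using pi pq(2,3) D t m1 m2 t' push_ext_add[of "push X C m1 \<delta>" C M "push X C m2 (push X C f \<delta>)"
        "Prj1 X D B \<cdot> p"] by simp
  also have "push X C (Prj1 X D B \<cdot> p) (push X C m1 \<delta>) = push X C a \<delta>"
    using pi pq(2,3) D t m1 m2 by (simp add: push_push a_def)
  also have "push X C (Prj1 X D B \<cdot> p) (push X C m2 (push X C f \<delta>)) = push X C f \<delta>"
    using pi pq(2,3) D t m1 m2 t' f push_push[of "push X C f \<delta>" C m2 "Prj1 X D B \<cdot> p"] by (simp add: p(1))
  finally have "push X C (a \<^bold>+ f) \<delta> = ext_zero X C D"
    using push_plus[of \<delta> C a f] a f t by simp
  then obtain h where h: "arr h" "src h = B" "tgt h = D" "a \<^bold>+ f = h \<cdot> x"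
    by (rule factors_through_inflation[OF T, rotated 3]) (use a f in auto)
  have "a \<^bold>+ \<^bold>- (h \<cdot> x) = \<^bold>- f"
    unfolding h(4)[symmetric] using a f by simp
  then have H': "etriangle X (A, col X A D B (\<^bold>- f) x, DSum X D B,
      row X D B E d (k \<^bold>+ d \<cdot> h), E, pull X A e \<delta>)"
    using shear[OF H a t(4-6) t'(4-6) k h(1-3)] by simp
  have g: "arr (k \<^bold>+ d \<cdot> h)" "src (k \<^bold>+ d \<cdot> h) = B" "tgt (k \<^bold>+ d \<cdot> h) = E"
    using k h t' by simp_all
  note hc = homotopy_cartesianI[OF H' f t(4-6) t'(4-6) g]
  have "e \<cdot> (d \<cdot> h) = (e \<cdot> d) \<cdot> h" using t' h(1-3) by simp
  then have "e \<cdot> (d \<cdot> h) = mor_zero X B C"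
    unfolding etriangle_comp_zero[OF T'] using h(1-3) t' by simp
  then have "e \<cdot> (k \<^bold>+ d \<cdot> h) = y" using ek k h(1-3) t t' by simp
  then have "etriangle_mor X (A, x, B, y, C, \<delta>) (D, d, E, e, C, push X C f \<delta>)
      (f, k \<^bold>+ d \<cdot> h, Ident X C)"
    unfolding etriangle_mor.simps using f g t t' hc(2) by simp
  then show "\<exists>g\<in>Hom X B E.
      etriangle_mor X (A, x, B, y, C, \<delta>) (D, d, E, e, C, push X C f \<delta>) (f, g, Ident X C) \<and>
      homotopy_cartesian X A B D E x f g d (pull X A e \<delta>)"
    using hc(1) g t t' by auto
qed

text \<open>
  Some \<open>f\<^sub>0\<close> completes \<open>g\<close> to a morphism of triangles. The hypothesis gives a homotopy cartesian square
  on \<open>f\<^sub>0\<close> and another morphism \<open>g'\<close>; now \<open>y\<^sub>2 (g - g') = 0\<close>, so \<open>g = g' + x\<^sub>2 h\<close>, and the shear by \<open>h\<close>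
  restores \<open>g\<close> at the price of replacing \<open>f\<^sub>0\<close> by \<open>f\<^sub>0 + h x\<^sub>1\<close>. The extension \<open>f\<^sub>*\<delta>\<close> is unaffected by
  that, as \<open>(x\<^sub>1)\<^sub>*\<delta> = 0\<close>.
\<close>

lemma ET4_2_imp_ET4_5:
  assumes E2: "ET4_2 X"
  shows "ET4_5 X"
  unfolding ET4_5_def
proof (intro allI impI, elim conjE)
  fix A1 x1 B1 y1 A2 x2 B2 y2 C \<delta> \<delta>' g
  assume T1: "etriangle X (A1, x1, B1, y1, C, \<delta>)" and T2: "etriangle X (A2, x2, B2, y2, C, \<delta>')"
    and gH: "g \<in> Hom X B1 B2" and yg: "y2 \<cdot> g = y1"
  note t1 = etriangleD[OF T1] and t2 = etriangleD[OF T2]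
  have g: "arr g" "src g = B1" "tgt g = B2" using gH t1 t2 by simp_all
  obtain f0 where m0: "etriangle_mor X (A1, x1, B1, y1, C, \<delta>) (A2, x2, B2, y2, C, \<delta>') (f0, g, Ident X C)"
    by (rule ET3_opE[OF T1 T2 g, of "Ident X C"]) (use t1 yg in auto)
  note f0 = etriangle_morD[OF m0 T1 T2]
  have p0: "push X C f0 \<delta> = \<delta>'" using f0(12) t2 by simp
  have T2': "etriangle X (A2, x2, B2, y2, C, push X C f0 \<delta>)" using T2 p0 by simp
  have "f0 \<in> Hom X A1 A2" using f0 t1 t2 by simp
  then obtain g' where
    m': "etriangle_mor X (A1, x1, B1, y1, C, \<delta>) (A2, x2, B2, y2, C, push X C f0 \<delta>) (f0, g', Ident X C)"
    and hc': "homotopy_cartesian X A1 B1 A2 B2 x1 f0 g' x2 (pull X A1 y2 \<delta>)"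
    using E2[unfolded ET4_2_def, rule_format, of A1 x1 B1 y1 C \<delta> A2 f0 x2 B2 y2] T1 T2' t2(1) by blast
  note g' = etriangle_morD[OF m' T1 T2']
  have "y2 \<cdot> (g \<^bold>+ \<^bold>- g') = mor_zero X B1 C"
    using t1 t2 g g'(1-9) yg g'(11) by simp
  then obtain h where h: "arr h" "src h = B1" "tgt h = A2" "g \<^bold>+ \<^bold>- g' = x2 \<cdot> h"
    by (rule inflation_weak_kernel[OF T2, rotated 3]) (use g g' in auto)
  define f where "f = f0 \<^bold>+ h \<cdot> x1"
  have f: "arr f" "src f = A1" "tgt f = A2" using f0(1-3) h t1 by (simp_all add: f_def)
  have "g' \<^bold>+ x2 \<cdot> h = g"
    unfolding h(4)[symmetric] using g g'(4-6) by (simp add: plus_left_commute[of g' g])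
  moreover have "\<^bold>- f0 \<^bold>+ \<^bold>- (h \<cdot> x1) = \<^bold>- f"
    using f0(1-3) h(1-3) t1 by (simp add: f_def)
  moreover have "etriangle X (A1, col X A1 A2 B1 (\<^bold>- f0 \<^bold>+ \<^bold>- (h \<cdot> x1)) x1, DSum X A2 B1,
      row X A2 B1 B2 x2 (g' \<^bold>+ x2 \<cdot> h), B2, pull X A1 y2 \<delta>)"
    by (rule shear[OF homotopy_cartesianD[OF hc' f0(1-3)]]) (use f0(1-3) t1 t2 g' h(1-3) in simp_all)
  ultimately have "etriangle X (A1, col X A1 A2 B1 (\<^bold>- f) x1, DSum X A2 B1,
      row X A2 B1 B2 x2 g, B2, pull X A1 y2 \<delta>)"
    by simp
  note hc = homotopy_cartesianI[OF this f t1(4-6) t2(4-6) g]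
  have "push X C f \<delta> = ext_add X C A2 (push X C f0 \<delta>) (push X C h (push X C x1 \<delta>))"
    unfolding f_def using t1 f0(1-3) h(1-3) by (simp add: push_plus push_push)
  also have "\<dots> = \<delta>'" unfolding p0 push_inflation[OF T1] using t1 t2 h(1-3) by simp
  finally have "push X C f \<delta> = \<delta>'" .
  then have "etriangle_mor X (A1, x1, B1, y1, C, \<delta>) (A2, x2, B2, y2, C, \<delta>') (f, g, Ident X C)"
    unfolding etriangle_mor.simps using f g t1 t2 hc(2) yg by simp
  then show "\<exists>f\<in>Hom X A1 A2.
      etriangle_mor X (A1, x1, B1, y1, C, \<delta>) (A2, x2, B2, y2, C, \<delta>') (f, g, Ident X C) \<and>
      homotopy_cartesian X A1 B1 A2 B2 x1 f g x2 (pull X A1 y2 \<delta>)"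
    using hc(1) f t1 t2 by auto
qed

text \<open>
  The same argument with the roles of \<open>f\<close> and \<open>g\<close> exchanged: some \<open>g\<^sub>0\<close> completes \<open>f\<close> to a morphism of
  triangles and belongs to a square on some \<open>f'\<close> with \<open>f'\<^sub>*\<delta> = f\<^sub>*\<delta>\<close>, so \<open>f - f' = h x\<close>, and the
  shear by \<open>h\<close> restores \<open>f\<close>.
\<close>

lemma ET4_5_imp_ET4_2:
  assumes E5: "ET4_5 X"
  shows "ET4_2 X"
  unfolding ET4_2_def
proof (intro allI impI, elim conjE)
  fix A x B y C \<delta> D f d E e
  assume T: "etriangle X (A, x, B, y, C, \<delta>)" and D: "D \<in> Obj X" and fH: "f \<in> Hom X A D"
    and T': "etriangle X (D, d, E, e, C, push X C f \<delta>)"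
  note t = etriangleD[OF T] and t' = etriangleD[OF T']
  have f: "arr f" "src f = A" "tgt f = D" using fH t D by simp_all
  have "ext_mor X C A C D \<delta> (push X C f \<delta>) f (Ident X C)"
    unfolding ext_mor_def using f t t' by simp
  then obtain g0 where g0H: "g0 \<in> Hom X B E" and g0x: "g0 \<cdot> x = d \<cdot> f" and "e \<cdot> g0 = Ident X C \<cdot> y"
    using real_mor[OF T T'] by blast
  then have eg0: "e \<cdot> g0 = y" using t by simp
  have g0: "arr g0" "src g0 = B" "tgt g0 = E" using g0H t t' by simp_all
  obtain f' where
    m': "etriangle_mor X (A, x, B, y, C, \<delta>) (D, d, E, e, C, push X C f \<delta>) (f', g0, Ident X C)"
    and hc': "homotopy_cartesian X A B D E x f' g0 d (pull X A e \<delta>)"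
    using E5[unfolded ET4_5_def, rule_format, of A x B y C \<delta> D d E e "push X C f \<delta>" g0] T T' g0H eg0
    by blast
  note f' = etriangle_morD[OF m' T T']
  have "push X C (f \<^bold>+ \<^bold>- f') \<delta> = ext_zero X C (tgt f)"
    by (rule push_diff_zero) (use f f' t t' in simp_all)
  then obtain h where h: "arr h" "src h = B" "tgt h = D" "f \<^bold>+ \<^bold>- f' = h \<cdot> x"
    using factors_through_inflation[OF T, of "f \<^bold>+ \<^bold>- f'" D] f f'(1-3) by auto
  define g where "g = g0 \<^bold>+ d \<cdot> h"
  have g: "arr g" "src g = B" "tgt g = E" using g0 h t' by (simp_all add: g_def)
  have "\<^bold>- f' \<^bold>+ \<^bold>- (h \<cdot> x) = \<^bold>- f"
    unfolding h(4)[symmetric] using f f'(1-3) by (simp add: plus_left_commute[of "\<^bold>- f'" "\<^bold>- f"])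
  moreover have "etriangle X (A, col X A D B (\<^bold>- f' \<^bold>+ \<^bold>- (h \<cdot> x)) x, DSum X D B,
      row X D B E d g, E, pull X A e \<delta>)"
    unfolding g_def
    by (rule shear[OF homotopy_cartesianD[OF hc' f'(1-3)]]) (use f'(1-3) t t' g0 h(1-3) in simp_all)
  ultimately have "etriangle X (A, col X A D B (\<^bold>- f) x, DSum X D B, row X D B E d g, E, pull X A e \<delta>)"
    by simp
  note hc = homotopy_cartesianI[OF this f t(4-6) t'(4-6) g]
  have "e \<cdot> (d \<cdot> h) = (e \<cdot> d) \<cdot> h" using t' h(1-3) by simp
  then have "e \<cdot> (d \<cdot> h) = mor_zero X B C"
    unfolding etriangle_comp_zero[OF T'] using h(1-3) t' by simp
  then have "e \<cdot> g = y" using eg0 g0 h(1-3) t t' by (simp add: g_def)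
  then have "etriangle_mor X (A, x, B, y, C, \<delta>) (D, d, E, e, C, push X C f \<delta>) (f, g, Ident X C)"
    unfolding etriangle_mor.simps using f g t t' hc(2) by simp
  then show "\<exists>g\<in>Hom X B E.
      etriangle_mor X (A, x, B, y, C, \<delta>) (D, d, E, e, C, push X C f \<delta>) (f, g, Ident X C) \<and>
      homotopy_cartesian X A B D E x f g d (pull X A e \<delta>)"
    using hc(1) g t t' by auto
qed

text \<open>
  The middle term \<open>G\<close> of \<open>e\<^sub>*\<delta>\<close> is identified with \<open>B \<oplus> D\<close>: both are cones of a morphism from \<open>A\<close> to
  the sum of \<open>E\<close> and \<open>B\<close>, since the pushout of \<open>f\<^sup>*\<delta>\<close> along \<open>-x\<close> is split. The sign of \<open>-x\<close> makes the
  columns \<open>(-e, x)\<close> and \<open>(x, e)\<close> of the two homotopy cartesian squares correspond under the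
  isomorphism \<open>(u, v) \<mapsto> (v, -u)\<close>.
\<close>

lemma ET4_2_imp_ET4_2_dual:
  assumes E2: "ET4_2 X"
  shows "ET4_2_dual X"
  unfolding ET4_2_dual_def
proof (intro allI impI, elim conjE)
  fix A x B y C \<delta> D f E e d
  assume T: "etriangle X (A, x, B, y, C, \<delta>)" and D: "D \<in> Obj X" and fH: "f \<in> Hom X D C"
    and U: "etriangle X (A, e, E, d, D, pull X A f \<delta>)"
  note t = etriangleD[OF T] and u = etriangleD[OF U]
  have f: "arr f" "src f = D" "tgt f = C" using fH t D by simp_all
  have eH: "e \<in> Hom X A E" and nxH: "\<^bold>- x \<in> Hom X A B" using t u by simp_all
  have "push X C e \<delta> \<in> carrier (Ext X C E)" using t u by simp
  then obtain p G w where P: "etriangle X (E, p, G, w, C, push X C e \<delta>)"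
    using etriangle_exists t(3) u(2) by blast
  note pP = etriangleD[OF P]
  obtain k where
    mk: "etriangle_mor X (A, x, B, y, C, \<delta>) (E, p, G, w, C, push X C e \<delta>) (e, k, Ident X C)"
    and hk: "homotopy_cartesian X A B E G x e k p (pull X A w \<delta>)"
    using E2[unfolded ET4_2_def, rule_format, of A x B y C \<delta> E e p G w] T P eH u(2) by blast
  note k = etriangle_morD[OF mk T P]
  have H1: "etriangle X (A, col X A E B (\<^bold>- e) x, DSum X E B, row X E B G p k, G, pull X A w \<delta>)"
    using homotopy_cartesianD[OF hk] u by simp
  have "push X C (\<^bold>- x) \<delta> = push X C (\<^bold>- Ident X B) (push X C x \<delta>)"
    using t by (simp add: push_push)
  also have "\<dots> = ext_zero X C B" unfolding push_inflation[OF T] using t by simp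
  finally have "push X D (\<^bold>- x) (pull X A f \<delta>) = ext_zero X D B"
    using push_pull[of \<delta> f "\<^bold>- x"] t f by simp
  then have S: "etriangle X (B, Inj1 X B D, DSum X B D, Prj2 X B D, D, push X D (\<^bold>- x) (pull X A f \<delta>))"
    using split_etriangle[OF t(2) D] by simp
  let ?\<theta> = "pull X A (Prj2 X B D) (pull X A f \<delta>)"
  obtain g' where
    mg: "etriangle_mor X (A, e, E, d, D, pull X A f \<delta>)
      (B, Inj1 X B D, DSum X B D, Prj2 X B D, D, push X D (\<^bold>- x) (pull X A f \<delta>)) (\<^bold>- x, g', Ident X D)"
    and hg: "homotopy_cartesian X A E B (DSum X B D) e (\<^bold>- x) g' (Inj1 X B D) ?\<theta>"
    using E2[unfolded ET4_2_def, rule_format, of A e E d D "pull X A f \<delta>" B "\<^bold>- x" "Inj1 X B D"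
        "DSum X B D" "Prj2 X B D"] U S nxH t(2) by blast
  note g' = etriangle_morD[OF mg U S]
  have H2: "etriangle X (A, col X A B E x e, DSum X B E, row X B E (DSum X B D) (Inj1 X B D) g',
      DSum X B D, ?\<theta>)"
    using homotopy_cartesianD[OF hg] t by simp
  define r where "r = col X (DSum X E B) B E (Prj2 X E B) (\<^bold>- Prj1 X E B)"
  have r: "arr r" "src r = DSum X E B" "tgt r = DSum X B E"
    using t u by (simp_all add: r_def)
  have rinv: "inverses r (col X (DSum X B E) E B (\<^bold>- Prj2 X B E) (Prj1 X B E))" (is "inverses r ?r'")
  proof -
    have "?r' \<cdot> r = Ident X (DSum X E B)"
      by (rule into_dsum_eqI[of _ _ E B]) (use t u in \<open>simp_all add: r_def\<close>)
    moreover have "r \<cdot> ?r' = Ident X (DSum X B E)"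
      by (rule into_dsum_eqI[of _ _ B E]) (use t u in \<open>simp_all add: r_def\<close>)
    ultimately show ?thesis unfolding inverses_def using r t u by simp
  qed
  have sq: "r \<cdot> col X A E B (\<^bold>- e) x = col X A B E x e \<cdot> Ident X A"
    using t u by (simp add: r_def)
  \<comment> \<open>The comparison of the two cones is induced by isomorphisms, so it is one itself.\<close>
  obtain \<phi> where m\<phi>: "etriangle_mor X
      (A, col X A E B (\<^bold>- e) x, DSum X E B, row X E B G p k, G, pull X A w \<delta>)
      (A, col X A B E x e, DSum X B E, row X B E (DSum X B D) (Inj1 X B D) g', DSum X B D, ?\<theta>)
      (Ident X A, r, \<phi>)"
    by (rule ET3E[OF H1 H2 _ _ _ r sq]) (use t in auto)
  note \<phi> = etriangle_morD[OF m\<phi> H1 H2]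
  have "inverses (Ident X A) (Ident X A)" using t by (simp add: inverses_def)
  then have "iso_mor X A A (Ident X A)" "iso_mor X (DSum X E B) (DSum X B E) r"
    using t u r rinv by (auto simp: iso_mor_iff)
  then have "iso_mor X G (DSum X B D) \<phi>"
    by (rule etriangle_mor_iso[OF H1 H2 m\<phi>])
  then obtain \<psi> where inv: "inverses \<phi> \<psi>"
    using pP t D by (auto simp: iso_mor_iff)
  note fi = inversesD[OF inv] inverses_cancel[OF inv]
  have "\<phi> \<cdot> p = (\<phi> \<cdot> row X E B G p k) \<cdot> Inj1 X E B"
    using \<phi>(7-9) pP k(4-6) t u by simp
  also have "\<dots> = row X B E (DSum X B D) (Inj1 X B D) g' \<cdot> (r \<cdot> Inj1 X E B)"
    unfolding \<phi>(11)[symmetric] using r g'(4-6) t u D by simp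
  also have "\<dots> = \<^bold>- g'"
    using g'(4-6) t u D by (simp add: r_def)
  finally have \<phi>p: "\<phi> \<cdot> p = \<^bold>- g'" .
  have "\<phi> \<cdot> k = (\<phi> \<cdot> row X E B G p k) \<cdot> Inj2 X E B"
    using \<phi>(7-9) pP k(4-6) t u by simp
  also have "\<dots> = row X B E (DSum X B D) (Inj1 X B D) g' \<cdot> (r \<cdot> Inj2 X E B)"
    unfolding \<phi>(11)[symmetric] using r g'(4-6) t u D by simp
  also have "\<dots> = Inj1 X B D"
    using g'(4-6) t u D by (simp add: r_def)
  finally have \<phi>k: "\<phi> \<cdot> k = Inj1 X B D" .
  \<comment> \<open>The triangle of \<open>e\<^sub>*\<delta>\<close>, with \<open>G\<close> replaced by \<open>B \<oplus> D\<close>. Its second morphism has entries \<open>y\<close> and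
    some \<open>f'\<close>; that \<open>\<phi>\<close> respects extensions forces \<open>f'\<^sup>*\<delta> = f\<^sup>*\<delta>\<close>.\<close>
  have Q: "etriangle X (E, \<^bold>- g', DSum X B D, w \<cdot> \<psi>, C, push X C e \<delta>)"
    using etriangle_transport[OF P inv \<phi>(8,9)] unfolding \<phi>p .
  define f' where "f' = w \<cdot> (\<psi> \<cdot> Inj2 X B D)"
  have f': "arr f'" "src f' = D" "tgt f' = C" using pP fi(1-4) \<phi>(8,9) t D by (simp_all add: f'_def)
  have "w \<cdot> (\<psi> \<cdot> Inj1 X B D) = w \<cdot> (\<psi> \<cdot> (\<phi> \<cdot> k))" unfolding \<phi>k ..
  also have "\<dots> = y" using fi \<phi>(8,9) k t by simp
  finally have row: "w \<cdot> \<psi> = row X B D C y f'"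
    using row_eta[of "w \<cdot> \<psi>" B D C] pP fi(1-4) \<phi>(8,9) t D by (simp add: f'_def)
  have "pull X A w \<delta> = pull X A (f \<cdot> (Prj2 X B D \<cdot> \<phi>)) \<delta>"
    using \<phi>(12) pP t f D \<phi>(7-9) by (simp add: pull_pull)
  then have "pull X A (\<psi> \<cdot> Inj2 X B D) (pull X A w \<delta>)
      = pull X A (\<psi> \<cdot> Inj2 X B D) (pull X A (f \<cdot> (Prj2 X B D \<cdot> \<phi>)) \<delta>)"
    by simp
  then have "pull X A f' \<delta> = pull X A f \<delta>"
    using pP t f D \<phi>(7-9) fi by (simp add: pull_pull f'_def)
  then have "pull X A (f' \<^bold>+ \<^bold>- f) \<delta> = ext_zero X (src f') A"
    by (intro pull_diff_zero) (use t f f' in simp_all)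
  then obtain h where h: "arr h" "src h = D" "tgt h = B" "f' \<^bold>+ \<^bold>- f = y \<cdot> h"
    using factors_through_deflation[OF T, of "f' \<^bold>+ \<^bold>- f" D] f f' by auto
  have f'_eq: "f' = f \<^bold>+ y \<cdot> h"
    unfolding h(4)[symmetric] using f f' by (simp add: plus_left_commute[of f f'])
  \<comment> \<open>The matrix \<open>q\<close> performs at once the exchange of the summands, the shear that turns \<open>f'\<close>
    into \<open>f\<close>, and the change of sign on \<open>D\<close>.\<close>
  define q where "q = col X (DSum X B D) D B (\<^bold>- Prj2 X B D) (Prj1 X B D \<^bold>+ h \<cdot> Prj2 X B D)"
  define q' where "q' = col X (DSum X D B) B D (Prj2 X D B \<^bold>+ h \<cdot> Prj1 X D B) (\<^bold>- Prj1 X D B)"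
  have q: "arr q" "src q = DSum X B D" "tgt q = DSum X D B"
    and q': "arr q'" "src q' = DSum X D B" "tgt q' = DSum X B D"
    using t D h(1-3) by (simp_all add: q_def q'_def)
  have "q' \<cdot> q = Ident X (DSum X B D)"
    by (rule into_dsum_eqI[of _ _ B D])
      (use t D h(1-3) in \<open>simp_all add: q_def q'_def plus_assoc\<close>)
  moreover have "q \<cdot> q' = Ident X (DSum X D B)"
    by (rule into_dsum_eqI[of _ _ D B])
      (use t D h(1-3) in \<open>simp_all add: q_def q'_def plus_assoc\<close>)
  ultimately have qinv: "inverses q q'"
    unfolding inverses_def using q q' by simp
  define g where "g = \<^bold>- (Prj1 X B D \<cdot> g') \<^bold>+ \<^bold>- (h \<cdot> d)"
  have g: "arr g" "src g = E" "tgt g = B" using g'(4-6) h(1-3) t u D by (simp_all add: g_def)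
  have pg: "Prj2 X B D \<cdot> g' = d" using g'(11) u by simp
  have col: "q \<cdot> \<^bold>- g' = col X E D B d g"
    by (rule into_dsum_eqI[of _ _ D B])
      (use g'(4-6) h(1-3) t u D in \<open>simp_all add: q_def g_def pg\<close>)
  have row': "row X B D C y f' \<cdot> q' = row X D B C (\<^bold>- f) y"
    by (rule from_dsum_eqI[of _ _ D B])
      (use t D f f' h(1-3) in \<open>simp_all add: q'_def\<close>, simp add: f'_eq plus_left_commute[of "y \<cdot> h" "\<^bold>- f"])
  have R: "etriangle X (E, col X E D B d g, DSum X D B, row X D B C (\<^bold>- f) y, C, push X C e \<delta>)"
    using etriangle_transport[OF Q qinv q(2,3)] unfolding col row row' .
  have "\<^bold>- (f \<cdot> d) \<^bold>+ y \<cdot> g = mor_zero X E C"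
    using etriangle_comp_zero[OF R] f g t u by simp
  then have yg: "y \<cdot> g = f \<cdot> d"
    using neg_unique[of "\<^bold>- (f \<cdot> d)" "y \<cdot> g"] f g t u by simp
  have ge: "g \<cdot> e = x"
    using g'(4-6) g'(10) h(1-3) t u D etriangle_comp_zero[OF U] by (simp add: g_def)
  show "\<exists>g\<in>Hom X E B. g \<cdot> e = x \<and> y \<cdot> g = f \<cdot> d \<and>
      etriangle X (E, col X E D B d g, DSum X D B, row X D B C (mor_neg X D C f) y, C, push X C e \<delta>)"
    by (intro bexI[of _ g] conjI) (use R yg ge g f t u D in simp_all)
qed

end

section \<open>The opposite category\<close>

context
  fixes X :: "('o, 'm, 'e) extcat"
begin

lemma opposite_sel [simp]:
  "Obj (opposite X) = Obj X"
  "Mor (opposite X) A B = Mor X B A"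
  "Comp (opposite X) g f = f \<cdot>\<^bsub>X\<^esub> g"
  "Ident (opposite X) = Ident X"
  "DSum (opposite X) = DSum X"
  "Inj1 (opposite X) = Prj1 X"
  "Inj2 (opposite X) = Prj2 X"
  "Prj1 (opposite X) = Inj1 X"
  "Prj2 (opposite X) = Inj2 X"
  "Ext (opposite X) C A = Ext X A C"
  "Emap (opposite X) c a = Emap X a c"
  "Real (opposite X) C A \<delta> = prod.swap ` Real X A C \<delta>"
  by (simp_all add: opposite_def)

lemma opposite_derived [simp]:
  "push (opposite X) C a \<delta> = pull X C a \<delta>"
  "pull (opposite X) A c \<delta> = push X A c \<delta>"
  "col (opposite X) A B C f g = row X B C A f g"
  "row (opposite X) A B C f g = col X C A B f g"
  "ext_mor (opposite X) C A C' A' \<delta> \<delta>' a c \<longleftrightarrow> ext_mor X A' C' A C \<delta>' \<delta> c a"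
  "etriangle_mor (opposite X) (A, x, B, y, C, \<delta>) (A', x', B', y', C', \<delta>') (a, b, c) \<longleftrightarrow>
     etriangle_mor X (C', y', B', x', A', \<delta>') (C, y, B, x, A, \<delta>) (c, b, a)"
  "iso_mor (opposite X) A B f \<longleftrightarrow> iso_mor X B A f"
  by (auto simp: push_def pull_def col_def row_def ext_mor_def etriangle_mor.simps iso_mor_def)

lemma ext_dsum_opposite [simp]:
  "ext_dsum (opposite X) C A C' A' \<delta> \<delta>' = ext_dsum X A C A' C' \<delta> \<delta>'"
  unfolding ext_dsum_def by (simp add: conj_commute conj_left_commute)

lemma additive_category_opposite:
  assumes "additive_category X"
  shows "additive_category (opposite X)"
proof -
  interpret additive_category X by fact
  show ?thesis
  proof (rule additive_category.intro)
    show "\<exists>Z\<in>Obj (opposite X). \<forall>A\<in>Obj (opposite X).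
        Hom (opposite X) Z A = {mor_zero (opposite X) Z A} \<and>
        Hom (opposite X) A Z = {mor_zero (opposite X) A Z}"
      using zero_object by auto
  qed (auto simp: hom_group dsum_ident)
qed

text \<open>
  Reversing the arrows turns an isomorphism of sequences into one in the opposite direction, which
  is why the two sequences change places; symmetry of the relation undoes this for classes.
\<close>

lemma seq_equiv_opposite:
  "((x, y), (x', y')) \<in> seq_equiv (opposite X) A C \<longleftrightarrow> ((y', x'), (y, x)) \<in> seq_equiv X C A"
  unfolding seq_equiv_def by auto

lemma seq_class_opposite:
  assumes "biadditive_ext X" "A \<in> Obj X" "C \<in> Obj X"
  shows "seq_class (opposite X) A C x y = prod.swap ` seq_class X C A y x"
proof -
  interpret biadditive_ext X by fact
  have "sym (seq_equiv X C A)" using equiv_seq_equiv assms(2,3) by (blast elim: equivE)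
  then have "((y', x'), (y, x)) \<in> seq_equiv X C A \<longleftrightarrow> ((y, x), (y', x')) \<in> seq_equiv X C A" for x' y'
    by (auto dest: symD)
  then show ?thesis
    unfolding seq_class_def by (force simp: seq_equiv_opposite)
qed

lemma etriangle_opposite [simp]:
  assumes "biadditive_ext X"
  shows "etriangle (opposite X) (A, x, B, y, C, \<delta>) \<longleftrightarrow> etriangle X (C, y, B, x, A, \<delta>)"
  using seq_class_opposite[OF assms] by (auto simp: etriangle.simps inj_image_eq_iff)

lemma biadditive_ext_opposite:
  assumes "biadditive_ext X"
  shows "biadditive_ext (opposite X)"
proof -
  interpret biadditive_ext X by fact
  show ?thesis
    by (rule biadditive_ext.intro[OF additive_category_opposite[OF additive_category_axioms]
          biadditive_ext_axioms.intro])
      (simp_all add: ext_group emap_hom emap_ident push_plus pull_plus)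
qed

lemma mor_dsum_opposite:
  assumes "additive_category X" "A \<in> Obj X" "A' \<in> Obj X" "B \<in> Obj X" "B' \<in> Obj X"
    "f \<in> Hom X B A" "f' \<in> Hom X B' A'"
  shows "mor_dsum (opposite X) A A' B B' f f' = mor_dsum X B B' A A' f f'"
proof -
  interpret additive_category X by fact
  show ?thesis using assms(2-) by (simp add: mor_dsum_def)
qed

lemma additive_realization_opposite:
  assumes "additive_realization X"
  shows "additive_realization (opposite X)"
proof -
  interpret additive_realization X by fact
  have bi: "biadditive_ext X" by unfold_locales
  interpret op: biadditive_ext "opposite X"
    using bi by (rule biadditive_ext_opposite)
  show ?thesis
  proof unfold_locales
    fix C A \<delta> assume a: "C \<in> Obj (opposite X)" "A \<in> Obj (opposite X)" "\<delta> \<in> carrier (Ext (opposite X) C A)"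
    then obtain x B y where T: "etriangle X (C, x, B, y, A, \<delta>)"
      using etriangle_exists[of A C \<delta>] by auto
    then have "Real (opposite X) C A \<delta> = seq_equiv (opposite X) A C `` {(y, x)}"
      using seq_class_opposite[OF bi, of A C y x] a by (simp add: etriangle.simps seq_class_def)
    moreover have "(y, x) \<in> sequences (opposite X) A C"
      using etriangleD[OF T] by (auto simp: sequences_def)
    ultimately show "Real (opposite X) C A \<delta> \<in> sequences (opposite X) A C // seq_equiv (opposite X) A C"
      by (simp add: quotientI)
  next
    fix A x B y C \<delta> A' x' B' y' C' \<delta>' a c
    assume "etriangle (opposite X) (A, x, B, y, C, \<delta>)" "etriangle (opposite X) (A', x', B', y', C', \<delta>')"
      "ext_mor (opposite X) C A C' A' \<delta> \<delta>' a c"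
    then show "\<exists>b\<in>Hom (opposite X) B B'. b \<cdot>\<^bsub>opposite X\<^esub> x = x' \<cdot>\<^bsub>opposite X\<^esub> a \<and>
        y' \<cdot>\<^bsub>opposite X\<^esub> b = c \<cdot>\<^bsub>opposite X\<^esub> y"
      using real_mor[of C' y' B' x' A' \<delta>' C y B x A \<delta> c a] bi by auto
  next
    fix C A assume o: "C \<in> Obj (opposite X)" "A \<in> Obj (opposite X)"
    \<comment> \<open>Reversing the split sequence on \<open>C\<close> and \<open>A\<close> leaves the summands in the wrong order.\<close>
    let ?t = "\<lambda>A C. col X (DSum X A C) C A (Prj2 X A C) (Prj1 X A C)"
    have "?t A C \<cdot>\<^bsub>X\<^esub> ?t C A = Ident X (DSum X C A)"
      if "A \<in> Obj X" "C \<in> Obj X" for A C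
      by (rule into_dsum_eqI[of _ _ C A]) (use that in simp_all)
    then have "inverses (?t C A) (?t A C)"
      unfolding inverses_def using o by simp
    from etriangle_transport[OF split_etriangle[of C A] this]
    have "etriangle X (C, ?t C A \<cdot>\<^bsub>X\<^esub> Inj1 X C A, DSum X A C, Prj2 X C A \<cdot>\<^bsub>X\<^esub> ?t A C, A, ext_zero X A C)"
      using o by simp
    moreover have "?t C A \<cdot>\<^bsub>X\<^esub> Inj1 X C A = col X C A C (mor_zero X C A) (Ident X C)"
      "Prj2 X C A \<cdot>\<^bsub>X\<^esub> ?t A C = row X A C A (Ident X A) (mor_zero X C A)"
      using o by (simp_all add: row_def)
    ultimately show "Real (opposite X) C A (ext_zero (opposite X) C A) =
        seq_class (opposite X) A C
          (col (opposite X) A A C (Ident (opposite X) A) (mor_zero (opposite X) A C))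
          (row (opposite X) A C C (mor_zero (opposite X) A C) (Ident (opposite X) C))"
      using o by (simp add: etriangle.simps seq_class_opposite[OF bi])
  next
    fix A x B y C \<delta> A' x' B' y' C' \<delta>'
    assume "etriangle (opposite X) (A, x, B, y, C, \<delta>)" "etriangle (opposite X) (A', x', B', y', C', \<delta>')"
    then have T: "etriangle X (C, y, B, x, A, \<delta>)" and T': "etriangle X (C', y', B', x', A', \<delta>')"
      using bi by simp_all
    note t = etriangleD[OF T] and t' = etriangleD[OF T']
    show "Real (opposite X) (DSum (opposite X) C C') (DSum (opposite X) A A')
          (ext_dsum (opposite X) C A C' A' \<delta> \<delta>') =
        seq_class (opposite X) (DSum (opposite X) A A') (DSum (opposite X) C C')
          (mor_dsum (opposite X) A A' B B' x x') (mor_dsum (opposite X) B B' C C' y y')"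
      using real_dsum[OF T T'] t t'
      by (simp add: seq_class_opposite[OF bi] mor_dsum_opposite[OF additive_category_axioms])
  qed
qed

lemma pre_extriangulated_opposite:
  assumes "pre_extriangulated X"
  shows "pre_extriangulated (opposite X)"
proof -
  interpret pre_extriangulated X by fact
  have bi: "biadditive_ext X" by unfold_locales
  interpret op: additive_realization "opposite X"
    by (rule additive_realization_opposite) unfold_locales
  show ?thesis
  proof unfold_locales
    fix A x B y C \<delta> A' x' B' y' C' \<delta>' a b
    assume "etriangle (opposite X) (A, x, B, y, C, \<delta>)" "etriangle (opposite X) (A', x', B', y', C', \<delta>')"
      "a \<in> Hom (opposite X) A A'" "b \<in> Hom (opposite X) B B'"
      "b \<cdot>\<^bsub>opposite X\<^esub> x = x' \<cdot>\<^bsub>opposite X\<^esub> a"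
    then show "\<exists>c\<in>Hom (opposite X) C C'.
        etriangle_mor (opposite X) (A, x, B, y, C, \<delta>) (A', x', B', y', C', \<delta>') (a, b, c)"
      using ET3_op[of C' y' B' x' A' \<delta>' C y B x A \<delta> b a] bi by auto
  next
    fix A x B y C \<delta> A' x' B' y' C' \<delta>' b c
    assume "etriangle (opposite X) (A, x, B, y, C, \<delta>)" "etriangle (opposite X) (A', x', B', y', C', \<delta>')"
      "b \<in> Hom (opposite X) B B'" "c \<in> Hom (opposite X) C C'"
      "y' \<cdot>\<^bsub>opposite X\<^esub> b = c \<cdot>\<^bsub>opposite X\<^esub> y"
    then show "\<exists>a\<in>Hom (opposite X) A A'.
        etriangle_mor (opposite X) (A, x, B, y, C, \<delta>) (A', x', B', y', C', \<delta>') (a, b, c)"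
      using ET3[of C' y' B' x' A' \<delta>' C y B x A \<delta> c b] bi by auto
  qed
qed

section \<open>Self-duality\<close>

lemma etriangle_mor_iso_dual:
  assumes pre: "pre_extriangulated X"
    and T: "etriangle X (A, x, B, y, C, \<delta>)" and T': "etriangle X (A', x', B', y', C', \<delta>')"
    and m: "etriangle_mor X (A, x, B, y, C, \<delta>) (A', x', B', y', C', \<delta>') (a, b, c)"
    and "iso_mor X B B' b" "iso_mor X C C' c"
  shows "iso_mor X A A' a"
proof -
  interpret pre_extriangulated X by fact
  have bi: "biadditive_ext X" by unfold_locales
  show ?thesis
    using pre_extriangulated.etriangle_mor_iso[OF pre_extriangulated_opposite[OF pre],
        of C' y' B' x' A' \<delta>' C y B x A \<delta> c b a] assms bi
    by simp
qed

lemma ET4_2_opposite: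
  assumes "pre_extriangulated X"
  shows "ET4_2 (opposite X) \<longleftrightarrow> ET4_2_dual X"
proof -
  interpret pre_extriangulated X by fact
  have bi: "biadditive_ext X" by unfold_locales
  show ?thesis
  proof
    assume E: "ET4_2 (opposite X)"
    show "ET4_2_dual X"
      unfolding ET4_2_dual_def
    proof (intro allI impI, elim conjE)
      fix A x B y C \<delta> D f E e d
      assume T: "etriangle X (A, x, B, y, C, \<delta>)" and D: "D \<in> Obj X" and f: "f \<in> Hom X D C"
        and U: "etriangle X (A, e, E, d, D, pull X A f \<delta>)"
      show "\<exists>g\<in>Hom X E B. g \<cdot>\<^bsub>X\<^esub> e = x \<and> y \<cdot>\<^bsub>X\<^esub> g = f \<cdot>\<^bsub>X\<^esub> d \<and>
          etriangle X (E, col X E D B d g, DSum X D B, row X D B C (mor_neg X D C f) y, C,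
            push X C e \<delta>)"
        using E[unfolded ET4_2_def, rule_format, of C y B x A \<delta> D f d E e] T D f U bi
          etriangleD[OF T] etriangleD[OF U]
        by (auto simp: etriangle_mor.simps homotopy_cartesian_def)
    qed
  next
    assume E: "ET4_2_dual X"
    show "ET4_2 (opposite X)"
      unfolding ET4_2_def
    proof (intro allI impI, elim conjE)
      fix A x B y C \<delta> D f d E e
      assume T: "etriangle (opposite X) (A, x, B, y, C, \<delta>)" and D: "D \<in> Obj (opposite X)"
        and f: "f \<in> Hom (opposite X) A D"
        and U: "etriangle (opposite X) (D, d, E, e, C, push (opposite X) C f \<delta>)"
      have T': "etriangle X (C, y, B, x, A, \<delta>)" and U': "etriangle X (C, e, E, d, D, pull X C f \<delta>)"
        using T U bi by simp_all
      show "\<exists>g\<in>Hom (opposite X) B E. etriangle_mor (opposite X) (A, x, B, y, C, \<delta>)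
            (D, d, E, e, C, push (opposite X) C f \<delta>) (f, g, Ident (opposite X) C) \<and>
          homotopy_cartesian (opposite X) A B D E x f g d (pull (opposite X) A e \<delta>)"
        using E[unfolded ET4_2_dual_def, rule_format, of C y B x A \<delta> D f e E d] T' D f U' bi
          etriangleD[OF T'] etriangleD[OF U']
        by (auto simp: etriangle_mor.simps homotopy_cartesian_def)
    qed
  qed
qed

text \<open>
  Let \<open>M\<close> and \<open>N\<close> be the middle terms of \<open>y\<^sub>2\<^sup>*\<delta>\<^sub>1\<close> and \<open>y\<^sub>1\<^sup>*\<delta>\<^sub>2\<close>. The hypothesis makes them cocones of
  the rows \<open>(-y\<^sub>2, y\<^sub>1)\<close> and \<open>(-y\<^sub>1, y\<^sub>2)\<close>, which differ by the exchange of the summands and the sign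
  \<open>-1\<close> on \<open>C\<close>. The resulting isomorphism \<open>a : M \<rightarrow> N\<close> carries the second triangle over to \<open>M\<close>, and
  \<open>a\<^sub>*(m\<^sub>1)\<^sub>*\<delta>\<^sub>1 = (-1)\<^sup>*n\<^sub>*\<delta>\<^sub>2\<close> becomes the relation between the two pushforwards.
\<close>

lemma ET4_2_dual_imp_ET4_1:
  assumes pre: "pre_extriangulated X" and E: "ET4_2_dual X"
  shows "ET4_1 X"
proof -
  interpret pre_extriangulated X by fact
  show ?thesis
    unfolding ET4_1_def
  proof (intro allI impI, elim conjE)
    fix A1 x1 B1 y1 A2 x2 B2 y2 C \<delta>1 \<delta>2
    assume T1: "etriangle X (A1, x1, B1, y1, C, \<delta>1)" and T2: "etriangle X (A2, x2, B2, y2, C, \<delta>2)"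
    note t1 = etriangleD[OF T1] and t2 = etriangleD[OF T2]
    have "pull X A1 y2 \<delta>1 \<in> carrier (Ext X B2 A1)" "pull X A2 y1 \<delta>2 \<in> carrier (Ext X B1 A2)"
      using t1 t2 by simp_all
    then obtain m1 M e1 n N n1 where U1: "etriangle X (A1, m1, M, e1, B2, pull X A1 y2 \<delta>1)"
      and U2: "etriangle X (A2, n, N, n1, B1, pull X A2 y1 \<delta>2)"
      using etriangle_exists[OF t2(2) t1(1)] etriangle_exists[OF t1(2) t2(1)] by blast
    note u1 = etriangleD[OF U1] and u2 = etriangleD[OF U2]
    have yH: "y2 \<in> Hom X B2 C" "y1 \<in> Hom X B1 C" using t1 t2 by simp_all
    obtain e2 where e2H: "e2 \<in> Hom X M B1" and e2: "e2 \<cdot>\<^bsub>X\<^esub> m1 = x1" "y1 \<cdot>\<^bsub>X\<^esub> e2 = y2 \<cdot>\<^bsub>X\<^esub> e1"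
      and "etriangle X (M, col X M B2 B1 e1 e2, DSum X B2 B1,
        row X B2 B1 C (mor_neg X B2 C y2) y1, C, push X C m1 \<delta>1)"
      using E[unfolded ET4_2_dual_def, rule_format, of A1 x1 B1 y1 C \<delta>1 B2 y2 m1 M e1] T1 U1 t2(2) yH
      by blast
    then have P1: "etriangle X (M, col X M B2 B1 e1 e2, DSum X B2 B1,
        row X B2 B1 C (\<^bold>- y2) y1, C, push X C m1 \<delta>1)"
      using t2 by simp
    obtain n2 where n2H: "n2 \<in> Hom X N B2" and n2: "n2 \<cdot>\<^bsub>X\<^esub> n = x2" "y2 \<cdot>\<^bsub>X\<^esub> n2 = y1 \<cdot>\<^bsub>X\<^esub> n1"
      and "etriangle X (N, col X N B1 B2 n1 n2, DSum X B1 B2,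
        row X B1 B2 C (mor_neg X B1 C y1) y2, C, push X C n \<delta>2)"
      using E[unfolded ET4_2_dual_def, rule_format, of A2 x2 B2 y2 C \<delta>2 B1 y1 n N n1] T2 U2 t1(2) yH
      by blast
    then have P2: "etriangle X (N, col X N B1 B2 n1 n2, DSum X B1 B2,
        row X B1 B2 C (\<^bold>- y1) y2, C, push X C n \<delta>2)"
      using t1 by simp
    have e2a: "arr e2" "src e2 = M" "tgt e2 = B1" and n2a: "arr n2" "src n2 = N" "tgt n2 = B2"
      using e2H n2H u1 u2 t1 t2 by simp_all
    define r where "r = col X (DSum X B2 B1) B1 B2 (Prj2 X B2 B1) (Prj1 X B2 B1)"
    define r' where "r' = col X (DSum X B1 B2) B2 B1 (Prj2 X B1 B2) (Prj1 X B1 B2)"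
    have r: "arr r" "src r = DSum X B2 B1" "tgt r = DSum X B1 B2"
      and r': "arr r'" "src r' = DSum X B1 B2" "tgt r' = DSum X B2 B1"
      using t1 t2 by (simp_all add: r_def r'_def)
    have "r' \<cdot>\<^bsub>X\<^esub> r = Ident X (DSum X B2 B1)"
      by (rule into_dsum_eqI[of _ _ B2 B1]) (use t1 t2 in \<open>simp_all add: r_def r'_def\<close>)
    moreover have "r \<cdot>\<^bsub>X\<^esub> r' = Ident X (DSum X B1 B2)"
      by (rule into_dsum_eqI[of _ _ B1 B2]) (use t1 t2 in \<open>simp_all add: r_def r'_def\<close>)
    ultimately have rinv: "inverses r r'"
      unfolding inverses_def using r r' by simp
    have cinv: "inverses (\<^bold>- Ident X C) (\<^bold>- Ident X C)"
      using t1 by (simp add: inverses_def)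
    have sq: "row X B1 B2 C (\<^bold>- y1) y2 \<cdot>\<^bsub>X\<^esub> r = \<^bold>- Ident X C \<cdot>\<^bsub>X\<^esub> row X B2 B1 C (\<^bold>- y2) y1"
      by (rule from_dsum_eqI[of _ _ B2 B1]) (use t1 t2 in \<open>simp_all add: r_def\<close>)
    obtain a where ma: "etriangle_mor X
        (M, col X M B2 B1 e1 e2, DSum X B2 B1, row X B2 B1 C (\<^bold>- y2) y1, C, push X C m1 \<delta>1)
        (N, col X N B1 B2 n1 n2, DSum X B1 B2, row X B1 B2 C (\<^bold>- y1) y2, C, push X C n \<delta>2)
        (a, r, \<^bold>- Ident X C)"
      by (rule ET3_opE[OF P1 P2 r _ _ _ sq]) (use t1 in auto)
    note a = etriangle_morD[OF ma P1 P2]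
    have "iso_mor X (DSum X B2 B1) (DSum X B1 B2) r" "iso_mor X C C (\<^bold>- Ident X C)"
      using t1 t2 r rinv cinv by (auto simp: iso_mor_iff)
    then have "iso_mor X M N a"
      by (rule etriangle_mor_iso_dual[OF pre P1 P2 ma])
    then obtain a' where inv: "inverses a a'"
      using u1 u2 by (auto simp: iso_mor_iff)
    note ai = inversesD[OF inv] inverses_cancel[OF inv]
    have ra: "col X M B1 B2 e2 e1 = col X M B1 B2 (n1 \<cdot>\<^bsub>X\<^esub> a) (n2 \<cdot>\<^bsub>X\<^esub> a)"
      using a(10) a(1-3) t1 t2 u1 u2 e2a n2a by (simp add: r_def)
    have "Prj1 X B1 B2 \<cdot>\<^bsub>X\<^esub> col X M B1 B2 e2 e1 = n1 \<cdot>\<^bsub>X\<^esub> a"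
      unfolding ra using a(1-3) u2 n2a by simp
    then have n1a: "n1 \<cdot>\<^bsub>X\<^esub> a = e2" using u1 e2a by simp
    have "Prj2 X B1 B2 \<cdot>\<^bsub>X\<^esub> col X M B1 B2 e2 e1 = n2 \<cdot>\<^bsub>X\<^esub> a"
      unfolding ra using a(1-3) u2 n2a by simp
    then have n2a': "n2 \<cdot>\<^bsub>X\<^esub> a = e1" using u1 e2a by simp
    define m2 where "m2 = a' \<cdot>\<^bsub>X\<^esub> n"
    have m2: "arr m2" "src m2 = A2" "tgt m2 = M"
      using ai a(1-3) u2 by (simp_all add: m2_def)
    have V2: "etriangle X (A2, m2, M, e2, B1, pull X A2 y1 \<delta>2)"
      using etriangle_transport[OF U2 inverses_sym[OF inv]] ai a(1-3) n1a by (simp add: m2_def)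
    have em: "e1 \<cdot>\<^bsub>X\<^esub> m2 = x2"
      using ai a(1-3) u2 n2a n2(1) by (simp flip: n2a' add: m2_def)
    have "push X C m1 \<delta>1 = push X C a' (push X C a (push X C m1 \<delta>1))"
      using ai a(1-3) u1 t1 by (simp add: push_push)
    also have "\<dots> = pull X M (\<^bold>- Ident X C) (push X C m2 \<delta>2)"
      unfolding a(12) using ai a(1-3) u1 u2 t1 t2
      by (simp add: push_pull push_push m2_def)
    finally have m1_push: "push X C m1 \<delta>1 = pull X M (\<^bold>- Ident X C) (push X C m2 \<delta>2)" .
    have "ext_zero X C M = pull X M (\<^bold>- Ident X C \<^bold>+ Ident X C) (push X C m2 \<delta>2)"
      using m2 t1 t2 u1 by simp
    also have "\<dots> = ext_add X C M (pull X M (\<^bold>- Ident X C) (push X C m2 \<delta>2)) (push X C m2 \<delta>2)"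
      by (subst pull_plus) (use m2 t1 t2 u1 in simp_all)
    finally have sum: "ext_add X C M (push X C m1 \<delta>1) (push X C m2 \<delta>2) = ext_zero X C M"
      unfolding m1_push ..
    show "\<exists>M m1 e1 m2 e2.
        etriangle X (A1, m1, M, e1, B2, pull X A1 y2 \<delta>1) \<and>
        etriangle X (A2, m2, M, e2, B1, pull X A2 y1 \<delta>2) \<and>
        e2 \<cdot>\<^bsub>X\<^esub> m1 = x1 \<and> e1 \<cdot>\<^bsub>X\<^esub> m2 = x2 \<and> y2 \<cdot>\<^bsub>X\<^esub> e1 = y1 \<cdot>\<^bsub>X\<^esub> e2 \<and>
        ext_add X C M (push X C m1 \<delta>1) (push X C m2 \<delta>2) = ext_zero X C M"
      by (intro exI conjI) (rule U1 V2 e2(1) em e2(2)[symmetric] sum)+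
  qed
qed

lemma ET4_1_iff_ET4_2:
  assumes "pre_extriangulated X"
  shows "ET4_1 X \<longleftrightarrow> ET4_2 X"
  using pre_extriangulated.ET4_1_imp_ET4_2 pre_extriangulated.ET4_2_imp_ET4_2_dual
    ET4_2_dual_imp_ET4_1 assms by blast

lemma ET4_2_iff_ET4_5:
  assumes "pre_extriangulated X"
  shows "ET4_2 X \<longleftrightarrow> ET4_5 X"
  using pre_extriangulated.ET4_2_imp_ET4_5 pre_extriangulated.ET4_5_imp_ET4_2 assms by blast

text \<open>The implications form a cycle through (ET4-1), (ET4-2) and the dual of (ET4-2).\<close>

lemma ET4_2_iff_opposite:
  assumes "pre_extriangulated X"
  shows "ET4_2 X \<longleftrightarrow> ET4_2 (opposite X)"
  using pre_extriangulated.ET4_1_imp_ET4_2 pre_extriangulated.ET4_2_imp_ET4_2_dual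
    ET4_2_dual_imp_ET4_1 ET4_2_opposite assms by blast

end

theorem theorem1p1:
  fixes X :: "('o, 'm, 'e) extcat"
  assumes "pre_extriangulated X"
  shows "(ET4_1 X \<longleftrightarrow> ET4_2 X) \<and> (ET4_2 X \<longleftrightarrow> ET4_5 X) \<and>
    (ET4_1 X \<longleftrightarrow> ET4_1 (opposite X)) \<and>
    (ET4_2 X \<longleftrightarrow> ET4_2 (opposite X)) \<and>
    (ET4_5 X \<longleftrightarrow> ET4_5 (opposite X))"
proof -
  have "pre_extriangulated (opposite X)" by (rule pre_extriangulated_opposite[OF assms])
  then show ?thesis
    using ET4_1_iff_ET4_2 ET4_2_iff_ET4_5 ET4_2_iff_opposite[OF assms] assms by blast
qed

end
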